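(* Assume $k\ge0$ and $a>0$ satisfies $a+2\langle k\rangle+N>2$, and either (a) $N=1$ and $a>0$, (b) $N\ge2$ and $a\in\{1,2\}$, or (c) $N=2$ and $a=2/n$ for some $n\in\mathbb{N}$. Assume $1<p\le q<\infty$ and that the exponents $\alpha<0$ and $l>0$ satisfy $\alpha>-\frac{2\langle k\rangle+N+a-2}{q}$, $l<\frac{2\langle k\rangle+N+a-2}{p}$ and \[\frac{1}{2\langle k\rangle+N+a-2}(\alpha+l)=\frac1{p'}-\frac1q .\] Then there is a finite constant $C$ such that \[\Bigl(\int_{\mathbb{R}^N}|\mathcal{F}_{k,a}f(\xi)|^q\|\xi\|^{\alpha q}\,d\mu_{k,a}(\xi)\Bigr)^{1/q}\le C\Bigl(\int_{\mathbb{R}^N}|f(x)|^p\|x\|^{lp}\,d\mu_{k,a}(x)\Bigr)^{1/p}\] holds for all $f\in L^p_v(\mathbb{R}^N,\vartheta_{k,a}(x)dx)$, where $v(x)=\|x\|^{lp}$.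
   Context: Let $N\ge1$ and let $\langle\cdot,\cdot\rangle$, $\|\cdot\|$ be the Euclidean inner product and norm on $\mathbb{R}^N$. Let $\mathcal{R}\subset\mathbb{R}^N\setminus\{0\}$ be a reduced root system with positive subsystem $\mathcal{R}^+$, let $r_\alpha(x)=x-2\frac{\langle\alpha,x\rangle}{\|\alpha\|^2}\alpha$, let $\mathfrak{C}$ be the finite group generated by the $r_\alpha$, and let $k:\mathcal{R}\to[0,\infty)$, $\alpha\mapsto k_\alpha$, be a $\mathfrak{C}$-invariant (multiplicity) function; $\langle k\rangle=\sum_{\alpha\in\mathcal{R}^+}k_\alpha$. For $a>0$ put $\vartheta_k(x)=\prod_{\alpha\in\mathcal{R}^+}|\langle\alpha,x\rangle|^{2k_\alpha}$, $\vartheta_{k,a}(x)=\|x\|^{a-2}\vartheta_k(x)$, $d\mu_{k,a}(x)=\vartheta_{k,a}(x)\,dx$, $L^p_{k,a}(\mathbb{R}^N)=L^p(\mathbb{R}^N,\mu_{k,a})$. The Dunkl Laplacian is $\Delta_kf(x)=\Delta f(x)+\sum_{\alpha\in\mathcal{R}^+}k_\alpha\bigl(\frac{2\langle\nabla f(x),\alpha\rangle}{\langle\alpha,x\rangle}-\|\alpha\|^2\frac{f(x)-f(r_\alpha x)}{\langle\alpha,x\rangle^2}\bigr)$. If $a+2\langle k\rangle+N>2$, the $(k,a)$-generalized Fourier transform is the unitary operator on $L^2_{k,a}(\mathbb{R}^N)$ given by $\mathcal{F}_{k,a}=\exp\bigl[\frac{i\pi}{2a}(2\langle k\rangle+N+a-2)\bigr]\exp\bigl[\frac{i\pi}{2a}(\|x\|^{2-a}\Delta_k-\|x\|^a)\bigr]$.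 Equivalently, it is the unitary operator determined by $\mathcal{F}_{k,a}\Phi_{\ell}(p,\cdot)=e^{-i\pi(\ell+m/a)}\Phi_\ell(p,\cdot)$ for $\ell,m\in\{0,1,2,\dots\}$ and $p$ a homogeneous polynomial of degree $m$ with $\Delta_kp=0$, where $\Phi_\ell(p,x)=p(x)L_\ell^{(\lambda_m)}(\frac2a\|x\|^a)e^{-\|x\|^a/a}$, $\lambda_m=\frac1a(2m+2\langle k\rangle+N-2)$, and $L_\ell^{(\lambda)}$ are Laguerre polynomials (these functions span a dense subspace). Standing assumption (boundedness of the integral kernel): there is a finite constant $C_0$ with $\|\mathcal{F}_{k,a}f\|_\infty\le C_0\|f\|_{L^1_{k,a}}$ for all $f\in L^1_{k,a}\cap L^2_{k,a}$. Then $\mathcal{F}_{k,a}$ extends by continuity to $L^1_{k,a}+L^2_{k,a}$. $L^p_v(\mathbb{R}^N,\vartheta_{k,a}(x)dx)$ is the space of (classes of) measurable $f$ with $\int|f|^pv\,d\mu_{k,a}<\infty$; here $p'=\frac{p}{p-1}$. *)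

theory Defs
  imports "HOL-Analysis.Analysis" "HOL-Probability.Essential_Supremum"
begin

section \<open>Root systems and multiplicity functions\<close>

definition root_reflection :: "real ^ 'n \<Rightarrow> real ^ 'n \<Rightarrow> real ^ 'n" where
  "root_reflection \<alpha> x = x - (2 * (\<alpha> \<bullet> x) / (norm \<alpha>)\<^sup>2) *\<^sub>R \<alpha>"

text \<open>As usual in Dunkl theory, the roots need neither span the space nor satisfy an
  integrality (crystallographic) condition.\<close>

definition reduced_root_system :: "(real ^ 'n) set \<Rightarrow> bool" where
  "reduced_root_system R \<longleftrightarrow>
     finite R \<and> 0 \<notin> R \<and>
     (\<forall>\<alpha>\<in>R. root_reflection \<alpha> ` R = R) \<and>
     (\<forall>\<alpha>\<in>R. R \<inter> range (\<lambda>t. t *\<^sub>R \<alpha>) = {\<alpha>, - \<alpha>})"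

definition positive_subsystem :: "(real ^ 'n) set \<Rightarrow> (real ^ 'n) set \<Rightarrow> bool" where
  "positive_subsystem R P \<longleftrightarrow>
     (\<exists>\<beta>. (\<forall>\<alpha>\<in>R. \<alpha> \<bullet> \<beta> \<noteq> 0) \<and> P = {\<alpha>\<in>R. \<alpha> \<bullet> \<beta> > 0})"

text \<open>Reflections are involutions, so closure under composition already gives the generated group.\<close>

inductive_set reflection_group :: "(real ^ 'n) set \<Rightarrow> (real ^ 'n \<Rightarrow> real ^ 'n) set"
  for R :: "(real ^ 'n) set" where
  one: "id \<in> reflection_group R"
| step: "g \<in> reflection_group R \<Longrightarrow> \<alpha> \<in> R \<Longrightarrow> root_reflection \<alpha> \<circ> g \<in> reflection_group R"

definition multiplicity_function :: "(real ^ 'n) set \<Rightarrow> (real ^ 'n \<Rightarrow> real) \<Rightarrow> bool" where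
  "multiplicity_function R k \<longleftrightarrow>
     (\<forall>\<alpha>\<in>R. k \<alpha> \<ge> 0) \<and> (\<forall>g\<in>reflection_group R. \<forall>\<alpha>\<in>R. k (g \<alpha>) = k \<alpha>)"

section \<open>The weighted measure and Lebesgue spaces\<close>

text \<open>Here and below \<open>P\<close> is the positive subsystem. Since \<open>0 powr 0 = 0\<close>, the weight can differ
  from the usual one on the hyperplanes orthogonal to the roots and at the origin,
  which are Lebesgue null sets.\<close>

definition dunkl_weight ::
    "(real ^ 'n) set \<Rightarrow> (real ^ 'n \<Rightarrow> real) \<Rightarrow> real \<Rightarrow> real ^ 'n \<Rightarrow> real" where
  "dunkl_weight P k a x =
     norm x powr (a - 2) * (\<Prod>\<alpha>\<in>P. \<bar>\<alpha> \<bullet> x\<bar> powr (2 * k \<alpha>))"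

definition dunkl_measure ::
    "(real ^ 'n) set \<Rightarrow> (real ^ 'n \<Rightarrow> real) \<Rightarrow> real \<Rightarrow> (real ^ 'n) measure" where
  "dunkl_measure P k a = density lebesgue (\<lambda>x. ennreal (dunkl_weight P k a x))"

text \<open>The homogeneous dimension of this measure.\<close>

definition hom_dim :: "(real ^ 'n) set \<Rightarrow> (real ^ 'n \<Rightarrow> real) \<Rightarrow> real \<Rightarrow> real" where
  "hom_dim P k a = 2 * (\<Sum>\<beta>\<in>P. k \<beta>) + real CARD('n) + a - 2"

definition weighted_Lp :: "'x measure \<Rightarrow> ('x \<Rightarrow> real) \<Rightarrow> real \<Rightarrow> ('x \<Rightarrow> complex) set" where
  "weighted_Lp M v p =
     {f \<in> borel_measurable M. integrable M (\<lambda>x. norm (f x) powr p * v x)}"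

abbreviation Lp_space :: "'x measure \<Rightarrow> real \<Rightarrow> ('x \<Rightarrow> complex) set" where
  "Lp_space M p \<equiv> weighted_Lp M (\<lambda>_. 1) p"

definition Linf_norm :: "'x measure \<Rightarrow> ('x \<Rightarrow> complex) \<Rightarrow> ennreal" where
  "Linf_norm M f = esssup M (\<lambda>x. ennreal (norm (f x)))"

section \<open>The Dunkl Laplacian and the functions \<open>\<Phi>\<^sub>\<ell>(p, \<cdot>)\<close>\<close>

definition laplacian :: "(real ^ 'n \<Rightarrow> complex) \<Rightarrow> real ^ 'n \<Rightarrow> complex" where
  "laplacian f x =
     (\<Sum>b\<in>Basis. frechet_derivative (\<lambda>y. frechet_derivative f (at y) b) (at x) b)"

text \<open>\<open>\<langle>\<nabla>f(x), \<alpha>\<rangle>\<close> is the derivative of \<open>f\<close> at \<open>x\<close> applied to \<open>\<alpha>\<close>.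
  The formula is meaningful only where no root is orthogonal to \<open>x\<close>.\<close>

definition dunkl_laplacian ::
    "(real ^ 'n) set \<Rightarrow> (real ^ 'n \<Rightarrow> real) \<Rightarrow> (real ^ 'n \<Rightarrow> complex) \<Rightarrow> real ^ 'n \<Rightarrow> complex" where
  "dunkl_laplacian P k f x = laplacian f x +
     (\<Sum>\<alpha>\<in>P. of_real (k \<alpha>) *
        (2 * frechet_derivative f (at x) \<alpha> / of_real (\<alpha> \<bullet> x)
         - of_real ((norm \<alpha>)\<^sup>2) * (f x - f (root_reflection \<alpha> x)) / of_real ((\<alpha> \<bullet> x)\<^sup>2)))"

definition homogeneous_polynomial :: "nat \<Rightarrow> (real ^ 'n \<Rightarrow> complex) \<Rightarrow> bool" where
  "homogeneous_polynomial m p \<longleftrightarrow>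
     polynomial_function p \<and> (\<forall>t x. p (t *\<^sub>R x) = of_real (t ^ m) * p x)"

text \<open>For a polynomial \<open>p\<close>, the function \<open>\<Delta>\<^sub>k p\<close> is a polynomial as well, given by the formula above on
  the dense set of points orthogonal to no root; hence \<open>\<Delta>\<^sub>k p = 0\<close> is tested there only.\<close>

definition k_harmonic ::
    "(real ^ 'n) set \<Rightarrow> (real ^ 'n \<Rightarrow> real) \<Rightarrow> (real ^ 'n \<Rightarrow> complex) \<Rightarrow> bool" where
  "k_harmonic P k p \<longleftrightarrow> (\<forall>x. (\<forall>\<alpha>\<in>P. \<alpha> \<bullet> x \<noteq> 0) \<longrightarrow> dunkl_laplacian P k p x = 0)"

definition laguerre :: "nat \<Rightarrow> real \<Rightarrow> real \<Rightarrow> real" where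
  "laguerre l \<nu> t =
     (\<Sum>j\<le>l. (-1) ^ j * ((real l + \<nu>) gchoose (l - j)) * t ^ j / fact j)"

definition Phi ::
    "(real ^ 'n) set \<Rightarrow> (real ^ 'n \<Rightarrow> real) \<Rightarrow> real \<Rightarrow> nat \<Rightarrow> nat \<Rightarrow> (real ^ 'n \<Rightarrow> complex)
      \<Rightarrow> real ^ 'n \<Rightarrow> complex" where
  "Phi P k a l m p x =
     (let \<nu> = (2 * real m + 2 * (\<Sum>\<alpha>\<in>P. k \<alpha>) + real CARD('n) - 2) / a in
      p x * of_real (laguerre l \<nu> (2 / a * norm x powr a) * exp (- (norm x powr a) / a)))"

section \<open>The generalized Fourier transform\<close>

text \<open>Operators on \<open>L\<^sup>2\<close> are maps on functions, with all identities understood almost everywhere.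
  Linearity and preservation of the inner product make such a map respect equality
  almost everywhere.\<close>

definition unitary_on_L2 :: "'x measure \<Rightarrow> (('x \<Rightarrow> complex) \<Rightarrow> ('x \<Rightarrow> complex)) \<Rightarrow> bool" where
  "unitary_on_L2 M F \<longleftrightarrow>
     (\<forall>f\<in>Lp_space M 2. F f \<in> Lp_space M 2) \<and>
     (\<forall>f\<in>Lp_space M 2. \<forall>g\<in>Lp_space M 2. \<forall>c d.
        AE x in M. F (\<lambda>y. c * f y + d * g y) x = c * F f x + d * F g x) \<and>
     (\<forall>f\<in>Lp_space M 2. \<forall>g\<in>Lp_space M 2.
        (\<integral>x. F f x * cnj (F g x) \<partial>M) = (\<integral>x. f x * cnj (g x) \<partial>M)) \<and>
     (\<forall>g\<in>Lp_space M 2. \<exists>f\<in>Lp_space M 2. AE x in M. F f x = g x)"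

text \<open>These conditions determine \<open>F\<close> up to equality almost everywhere, as the functions
  \<open>\<Phi>\<^sub>\<ell>(p, \<cdot>)\<close> span a dense subspace of \<open>L\<^sup>2\<close>.\<close>

definition ka_fourier_transform ::
    "(real ^ 'n) set \<Rightarrow> (real ^ 'n \<Rightarrow> real) \<Rightarrow> real
      \<Rightarrow> ((real ^ 'n \<Rightarrow> complex) \<Rightarrow> (real ^ 'n \<Rightarrow> complex)) \<Rightarrow> bool" where
  "ka_fourier_transform P k a F \<longleftrightarrow>
     unitary_on_L2 (dunkl_measure P k a) F \<and>
     (\<forall>l m p. homogeneous_polynomial m p \<and> k_harmonic P k p \<longrightarrow>
        (AE x in dunkl_measure P k a.
           F (Phi P k a l m p) x = cis (- pi * (real l + real m / a)) * Phi P k a l m p x))"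

definition L1_Linf_bounded :: "'x measure \<Rightarrow> (('x \<Rightarrow> complex) \<Rightarrow> ('x \<Rightarrow> complex)) \<Rightarrow> bool" where
  "L1_Linf_bounded M F \<longleftrightarrow>
     (\<exists>C0\<ge>0. \<forall>f \<in> Lp_space M 1 \<inter> Lp_space M 2.
        Linf_norm M (F f) \<le> ennreal (C0 * (\<integral>x. norm (f x) \<partial>M)))"

text \<open>Extension by continuity to \<open>L\<^sup>1 + L\<^sup>2\<close>: if \<open>f = f1 + f2\<close> with \<open>f1 \<in> L\<^sup>1\<close>, \<open>f2 \<in> L\<^sup>2\<close>
  and \<open>u n \<in> L\<^sup>1 \<inter> L\<^sup>2\<close> tends to \<open>f1\<close> in \<open>L\<^sup>1\<close>, then the value at \<open>f\<close> is the limit of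
  \<open>F (u n)\<close> in \<open>L\<^sup>\<infinity>\<close> plus \<open>F f2\<close>. For \<open>F\<close> unitary and satisfying \<open>L1_Linf_bounded\<close> the value
  exists and is unique up to equality almost everywhere; for \<open>f\<close> outside \<open>L\<^sup>1 + L\<^sup>2\<close>
  nothing is known about it.\<close>

definition L1_L2_extension ::
    "'x measure \<Rightarrow> (('x \<Rightarrow> complex) \<Rightarrow> ('x \<Rightarrow> complex)) \<Rightarrow> ('x \<Rightarrow> complex) \<Rightarrow> ('x \<Rightarrow> complex)" where
  "L1_L2_extension M F f =
     (SOME g. g \<in> borel_measurable M \<and>
        (\<exists>f1\<in>Lp_space M 1. \<exists>f2\<in>Lp_space M 2. \<exists>u.
           (AE x in M. f x = f1 x + f2 x) \<and>
           (\<forall>n::nat. u n \<in> Lp_space M 1 \<inter> Lp_space M 2) \<and>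
           (\<lambda>n. \<integral>x. norm (u n x - f1 x) \<partial>M) \<longlonglongrightarrow> 0 \<and>
           (\<lambda>n. Linf_norm M (\<lambda>x. F (u n) x + F f2 x - g x)) \<longlonglongrightarrow> 0))"

end

theory Submission
  imports Defs
begin

text \<open>Only two properties of the transform enter: it is an isometry of \<open>L\<^sup>2\<close> and it maps \<open>L\<^sup>1\<close> to
  \<open>L\<^sup>\<infinity>\<close>. The measure enters through the bound \<open>K r\<^sup>D\<close> for the mass of dyadic shells. Cut a function into
  the level sets \<open>2\<^sup>n \<le> |f| < 2\<^bsup>n+1\<^esup>\<close>, of measure \<open>m\<^sub>n\<close>. Since the weight \<open>\<parallel>x\<parallel>\<^bsup>lp\<^esup>\<close> increases, a level set
  contributes at least a constant times \<open>(2\<^sup>n m\<^sub>n\<^bsup>1/p+l/D\<^esup>)\<^sup>p\<close> to the right-hand side. Collect the levels with \<open>m\<^sub>n\<close> in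
  \<open>[2\<^sup>j, 2\<^bsup>j+1\<^esup>)\<close> into one piece. By the two endpoint bounds its transform, measured in the
  target norm, is concentrated where \<open>\<parallel>\<xi>\<parallel>\<^sup>D 2\<^sup>j\<close> is about 1 and decays like a power away from it,
  so the pieces can be summed by convexity; \<open>p \<le> q\<close> gives the embedding of sequence spaces.\<close>

section \<open>Power integrals\<close>

text \<open>The pieces are indexed by measure, not by height, because the transform of a piece sits
  at a scale fixed by its measure alone: levels of equal measure would pile up at the same place,
  where no decay separates them. Inside a piece the heights are distinct powers of 2, so its highest
  level controls the geometric sums in both norms. The decay is encoded as a factor min y (1 / y) to
  the power -\<gamma>, with y = V^(1/D) \<rho>, placed inside the target integral; weighted
  convexity then spends it on the sum over j. Some \<gamma> > 0 is available because of strict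
  inequalities: \<alpha> > -D/q near the origin, and far out \<alpha> < 0 if q \<ge> 2, or l > 0
  with p \<le> q if q < 2. The transform is known to be additive only for finite sums and almost
  everywhere, and it is defined on L1 + L2 only by a choice. Hence the estimate is proved for
  truncations with finitely many levels, with a constant independent of the truncation, and Fatou's
  lemma carries it to all f.\<close>

lemma powr_dyadic_le:
  fixes r y e :: real
  assumes "0 < r" "r \<le> y" "y < 2 * r"
  shows "y powr e \<le> 2 powr \<bar>e\<bar> * r powr e"
proof -
  have q: "1 \<le> y / r" "y / r \<le> 2" using assms by (auto simp: field_simps)
  have "(y / r) powr e \<le> (y / r) powr \<bar>e\<bar>" using q by (intro powr_mono) auto
  also have "\<dots> \<le> 2 powr \<bar>e\<bar>" using q by (intro powr_mono2) auto
  finally have "(y / r) powr e * r powr e \<le> 2 powr \<bar>e\<bar> * r powr e"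
    by (intro mult_right_mono) auto
  moreover have "(y / r) powr e * r powr e = y powr e"
    using assms by (simp add: powr_mult[symmetric])
  ultimately show ?thesis by simp
qed

lemma ennreal_term_le_suminf:
  fixes f :: "nat \<Rightarrow> ennreal"
  shows "f k \<le> (\<Sum>k. f k)"
  using sum_le_suminf[of f "{k}"] by simp

locale gauge_space =
  fixes M :: "'x measure" and \<rho> :: "'x \<Rightarrow> real" and D K :: real
  assumes rho_measurable [measurable]: "\<rho> \<in> borel_measurable M"
    and rho_pos: "AE x in M. \<rho> x > 0"
    and D_pos: "D > 0" and K_nonneg: "K \<ge> 0"
    and shell: "\<And>r. r > 0 \<Longrightarrow> emeasure M {x \<in> space M. r \<le> \<rho> x \<and> \<rho> x < 2 * r} \<le> ennreal (K * r powr D)"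
begin

text \<open>Integrals over a ball and over its complement are both geometric series over shells of
  radius R \<theta>^k: for \<theta> = 1/2 the shells shrink to the origin, for \<theta> = 2 they run
  off to infinity. No shell contains a point of gauge 0, so \<open>cover\<close> concerns \<rho> x >
  0 only; the other points form a null set.\<close>

lemma power_integral_shells:
  assumes S: "S \<in> sets M" and R: "R > 0" and th: "\<theta> > 0" "\<theta> powr (e + D) < 1"
    and cover: "\<And>x. x \<in> S \<Longrightarrow> \<rho> x > 0 \<Longrightarrow> \<exists>k::nat. R * \<theta> ^ k \<le> \<rho> x \<and> \<rho> x < 2 * (R * \<theta> ^ k)"
  shows "(\<integral>\<^sup>+x. ennreal (\<rho> x powr e) * indicator S x \<partial>M)
     \<le> ennreal (2 powr \<bar>e\<bar> * K / (1 - \<theta> powr (e + D)) * R powr (e + D))"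
proof -
  let ?r = "\<lambda>k::nat. R * \<theta> ^ k"
  let ?A = "\<lambda>k. {x \<in> space M. ?r k \<le> \<rho> x \<and> \<rho> x < 2 * ?r k}"
  let ?c = "\<lambda>k. 2 powr \<bar>e\<bar> * ?r k powr e"
  have r: "?r k > 0" for k using R th by simp
  have "(\<integral>\<^sup>+x. ennreal (\<rho> x powr e) * indicator S x \<partial>M)
      \<le> (\<integral>\<^sup>+x. (\<Sum>k. ennreal (?c k) * indicator (?A k) x) \<partial>M)"
  proof (rule nn_integral_mono_AE, use rho_pos in eventually_elim)
    case (elim x)
    show ?case
    proof (cases "x \<in> S")
      case True
      then obtain k where k: "?r k \<le> \<rho> x" "\<rho> x < 2 * ?r k" using cover elim by blast
      have xs: "x \<in> space M" using True S sets.sets_into_space by auto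
      have "ennreal (\<rho> x powr e) \<le> ennreal (?c k) * indicator (?A k) x"
        using powr_dyadic_le[OF r k] k xs by (simp add: ennreal_leI)
      also have "\<dots> \<le> (\<Sum>k. ennreal (?c k) * indicator (?A k) x)"
        by (rule ennreal_term_le_suminf)
      finally show ?thesis using True by simp
    qed simp
  qed
  also have "\<dots> = (\<Sum>k. ennreal (?c k) * emeasure M (?A k))"
    by (subst nn_integral_suminf) (simp_all add: nn_integral_cmult_indicator)
  also have "\<dots> \<le> (\<Sum>k. ennreal (2 powr \<bar>e\<bar> * K * R powr (e + D)) * ennreal (\<theta> powr (e + D)) ^ k)"
  proof (rule suminf_le)
    fix k
    have "ennreal (?c k) * emeasure M (?A k) \<le> ennreal (?c k) * ennreal (K * ?r k powr D)"
      by (intro mult_left_mono shell r) simp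
    also have "\<dots> = ennreal (2 powr \<bar>e\<bar> * K * (?r k powr (e + D)))"
      by (simp add: ennreal_mult[symmetric] K_nonneg powr_add mult_ac)
    also have "?r k powr (e + D) = R powr (e + D) * (\<theta> powr (e + D)) ^ k"
    proof -
      have "(\<theta> ^ k) powr (e + D) = (\<theta> powr (e + D)) ^ k"
        using th by (simp add: powr_realpow[symmetric] powr_powr mult.commute)
      then show ?thesis using R th by (simp add: powr_mult)
    qed
    finally show "ennreal (?c k) * emeasure M (?A k)
        \<le> ennreal (2 powr \<bar>e\<bar> * K * R powr (e + D)) * ennreal (\<theta> powr (e + D)) ^ k"
      by (simp add: ennreal_mult[symmetric] K_nonneg ennreal_power mult_ac)
  qed auto
  also have "\<dots> = (\<Sum>k. ennreal (2 powr \<bar>e\<bar> * K * R powr (e + D) * (\<theta> powr (e + D)) ^ k))"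
    by (simp add: ennreal_power ennreal_mult[symmetric] K_nonneg)
  also have "\<dots> = ennreal (2 powr \<bar>e\<bar> * K * R powr (e + D) * (1 / (1 - \<theta> powr (e + D))))"
    using th by (intro suminf_ennreal_eq sums_mult geometric_sums) (auto simp: K_nonneg)
  finally show ?thesis by (simp add: field_simps)
qed

lemma near_power_integral:
  assumes e: "e > - D"
  obtains C where "C > 0"
    "\<And>R. R > 0 \<Longrightarrow> (\<integral>\<^sup>+x. ennreal (\<rho> x powr e) * indicator {x \<in> space M. \<rho> x < R} x \<partial>M)
        \<le> ennreal (C * R powr (e + D))"
proof -
  have th: "(1/2::real) powr (e + D) < 1"
    using e powr_less_mono'[of "1/2::real" 0 "e + D"] by simp
  define C0 where "C0 = 2 powr \<bar>e\<bar> * K / (1 - (1/2) powr (e + D)) * (1/2) powr (e + D)"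
  have C0: "C0 \<ge> 0" using th K_nonneg by (simp add: C0_def)
  have main: "(\<integral>\<^sup>+x. ennreal (\<rho> x powr e) * indicator {x \<in> space M. \<rho> x < R} x \<partial>M)
        \<le> ennreal (C0 * R powr (e + D))" if R: "R > 0" for R
  proof -
    have "(\<integral>\<^sup>+x. ennreal (\<rho> x powr e) * indicator {x \<in> space M. \<rho> x < R} x \<partial>M)
      \<le> ennreal (2 powr \<bar>e\<bar> * K / (1 - (1/2) powr (e + D)) * (R/2) powr (e + D))"
    proof (rule power_integral_shells)
      fix x assume x: "x \<in> {x \<in> space M. \<rho> x < R}" "\<rho> x > 0"
      \<comment> \<open>The least such k names the shell of x: failure at the previous index is the
        upper bound, and for k = 0 that bound is \<rho> x < R. The radii start at R / 2 because a
        shell of radius r reaches up to 2 r.\<close>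
      define P where "P k \<longleftrightarrow> R / 2 * (1/2) ^ k \<le> \<rho> x" for k :: nat
      have "\<exists>k. P k"
      proof -
        obtain k where "(1/2::real) ^ k < \<rho> x / (R/2)"
          using real_arch_pow_inv[of "\<rho> x / (R/2)" "1/2::real"] x R by auto
        then have "(1/2) ^ k * (R/2) < \<rho> x" using R by (simp only: pos_less_divide_eq half_gt_zero)
        then have "P k" unfolding P_def by (subst mult.commute) simp
        then show ?thesis by blast
      qed
      then have k: "P (LEAST k. P k)" by (metis LeastI)
      define k where "k = (LEAST k. P k)"
      have "\<rho> x < 2 * (R / 2 * (1/2) ^ k)"
      proof (cases k)
        case 0 then show ?thesis using x by simp
      next
        case (Suc n)
        then have "\<not> P n" using not_less_Least[of n P] k_def by auto
        then show ?thesis using Suc by (simp add: P_def)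
      qed
      then show "\<exists>k::nat. R / 2 * (1/2) ^ k \<le> \<rho> x \<and> \<rho> x < 2 * (R / 2 * (1/2) ^ k)"
        using k unfolding k_def[symmetric] unfolding P_def by (intro exI[of _ k] conjI)
    qed (use R th in auto)
    also have "(R/2) powr (e + D) = (1/2) powr (e + D) * R powr (e + D)"
      using R by (simp add: powr_mult[symmetric])
    finally show ?thesis by (simp add: C0_def mult_ac)
  qed
  show ?thesis
  \<comment> \<open>If K = 0 then C0 = 0; adding 1 makes the constant positive, since
    \<open>power_integral_lower_bound\<close> divides by it.\<close>
  proof (rule that[of "C0 + 1"])
    fix R :: real assume "R > 0"
    then show "(\<integral>\<^sup>+x. ennreal (\<rho> x powr e) * indicator {x \<in> space M. \<rho> x < R} x \<partial>M)
        \<le> ennreal ((C0 + 1) * R powr (e + D))"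
      using C0 by (intro order_trans[OF main]) (auto intro!: ennreal_leI mult_right_mono)
  qed (use C0 in simp)
qed

lemma far_power_integral:
  assumes e: "e < - D"
  obtains C where "C \<ge> 0"
    "\<And>R. R > 0 \<Longrightarrow> (\<integral>\<^sup>+x. ennreal (\<rho> x powr e) * indicator {x \<in> space M. R \<le> \<rho> x} x \<partial>M)
        \<le> ennreal (C * R powr (e + D))"
proof -
  have th: "2 powr (e + D) < 1"
    using e powr_less_mono[of "e + D" 0 2] by simp
  show ?thesis
  proof (rule that[of "2 powr \<bar>e\<bar> * K / (1 - 2 powr (e + D))"])
    fix R :: real assume R: "R > 0"
    show "(\<integral>\<^sup>+x. ennreal (\<rho> x powr e) * indicator {x \<in> space M. R \<le> \<rho> x} x \<partial>M)
        \<le> ennreal (2 powr \<bar>e\<bar> * K / (1 - 2 powr (e + D)) * R powr (e + D))"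
    proof (rule power_integral_shells)
      fix x assume x: "x \<in> {x \<in> space M. R \<le> \<rho> x}" "\<rho> x > 0"
      define P where "P k \<longleftrightarrow> \<rho> x < 2 * (R * 2 ^ k)" for k :: nat
      have "\<exists>k. P k"
      proof -
        obtain k where "\<rho> x / (2 * R) < 2 ^ k"
          using real_arch_pow[of 2 "\<rho> x / (2 * R)"] by auto
        then have "\<rho> x < 2 ^ k * (2 * R)" using R by (simp add: pos_divide_less_eq)
        then have "P k" unfolding P_def by (simp add: mult_ac)
        then show ?thesis by blast
      qed
      then have k: "P (LEAST k. P k)" by (metis LeastI)
      define k where "k = (LEAST k. P k)"
      have "R * 2 ^ k \<le> \<rho> x"
      proof (cases k)
        case 0 then show ?thesis using x by simp
      next
        case (Suc n)
        then have "\<not> P n" using not_less_Least[of n P] k_def by auto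
        then show ?thesis using Suc by (simp add: P_def)
      qed
      then show "\<exists>k::nat. R * 2 ^ k \<le> \<rho> x \<and> \<rho> x < 2 * (R * 2 ^ k)"
        using k unfolding k_def[symmetric] unfolding P_def by (intro exI[of _ k] conjI)
    qed (use R th in auto)
  qed (use th K_nonneg in auto)
qed

lemma ball_measure:
  obtains C where "C > 0"
    "\<And>R. R > 0 \<Longrightarrow> emeasure M {x \<in> space M. \<rho> x < R} \<le> ennreal (C * R powr D)"
proof -
  obtain C where C: "C > 0"
    "\<And>R. R > 0 \<Longrightarrow> (\<integral>\<^sup>+x. ennreal (\<rho> x powr 0) * indicator {x \<in> space M. \<rho> x < R} x \<partial>M)
        \<le> ennreal (C * R powr (0 + D))"
    using near_power_integral[of 0] D_pos by auto
  show ?thesis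
  proof (rule that[OF C(1)])
    fix R :: real assume "R > 0"
    have "emeasure M {x \<in> space M. \<rho> x < R} = (\<integral>\<^sup>+x. indicator {x \<in> space M. \<rho> x < R} x \<partial>M)"
      by simp
    \<comment> \<open>The integrand \<open>\<rho> x powr 0\<close> is 1 only where \<rho> x is
      nonzero, hence almost everywhere.\<close>
    also have "\<dots> = (\<integral>\<^sup>+x. ennreal (\<rho> x powr 0) * indicator {x \<in> space M. \<rho> x < R} x \<partial>M)"
      using rho_pos by (intro nn_integral_cong_AE) (auto elim: eventually_mono)
    finally show "emeasure M {x \<in> space M. \<rho> x < R} \<le> ennreal (C * R powr D)"
      using C(2)[OF \<open>R > 0\<close>] by simp
  qed
qed

text \<open>A set of measure \<open>m\<close> has at least half of its mass outside a ball of measure at most \<open>m / 2\<close>.\<close>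

lemma power_integral_lower_bound:
  assumes e: "e \<ge> 0"
  obtains c where "c > 0"
    "\<And>A m. A \<in> sets M \<Longrightarrow> m \<ge> 0 \<Longrightarrow> emeasure M A = ennreal m \<Longrightarrow>
       ennreal (c * m powr (1 + e / D)) \<le> (\<integral>\<^sup>+x. ennreal (\<rho> x powr e) * indicator A x \<partial>M)"
proof -
  obtain C where C: "C > 0"
    "\<And>R. R > 0 \<Longrightarrow> emeasure M {x \<in> space M. \<rho> x < R} \<le> ennreal (C * R powr D)"
    using ball_measure by auto
  define c where "c = (1 / (2 * C)) powr (e / D) / 2"
  show ?thesis
  proof (rule that)
    show "c > 0" using C by (simp add: c_def)
    fix A m assume A: "A \<in> sets M" "m \<ge> 0" "emeasure M A = ennreal m"
    show "ennreal (c * m powr (1 + e / D)) \<le> (\<integral>\<^sup>+x. ennreal (\<rho> x powr e) * indicator A x \<partial>M)"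
    proof (cases "m = 0")
      case False
      then have m: "m > 0" using A by simp
      \<comment> \<open>R solves C R^D = m / 2, so the ball takes at most half of the mass of A; c
        collects what R^e m / 2 contains besides the power of m.\<close>
      define R where "R = (m / (2 * C)) powr (1 / D)"
      have R: "R > 0" using m C by (simp add: R_def)
      have RD: "R powr D = m / (2 * C)" using m C D_pos by (simp add: R_def powr_powr)
      let ?B = "{x \<in> space M. \<rho> x < R}"
      have B: "emeasure M ?B \<le> ennreal (m / 2)" using C(2)[OF R] C(1) by (simp add: RD)
      have "ennreal m \<le> emeasure M (A - ?B) + emeasure M ?B"
      proof -
        have "emeasure M A \<le> emeasure M ((A - ?B) \<union> ?B)" using A by (intro emeasure_mono) auto
        also have "\<dots> \<le> emeasure M (A - ?B) + emeasure M ?B"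
          using A by (intro emeasure_subadditive) auto
        finally show ?thesis using A by simp
      qed
      also have "\<dots> \<le> emeasure M (A - ?B) + ennreal (m / 2)" by (intro add_left_mono B)
      finally have "ennreal m - ennreal (m / 2) \<le> emeasure M (A - ?B)"
        by (simp add: ennreal_minus_le_iff add.commute)
      then have half: "ennreal (m / 2) \<le> emeasure M (A - ?B)"
        using m by (simp add: ennreal_minus)
      have "ennreal (c * m powr (1 + e / D)) = ennreal (R powr e) * ennreal (m / 2)"
      proof -
        have "R powr e = (m / (2 * C)) powr (e / D)" by (simp add: R_def powr_powr)
        also have "\<dots> = m powr (e / D) * (1 / (2 * C)) powr (e / D)"
          using m C by (subst powr_mult[symmetric]) auto
        finally show ?thesis
          using m by (simp add: ennreal_mult[symmetric] c_def powr_add)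
      qed
      also have "\<dots> \<le> ennreal (R powr e) * emeasure M (A - ?B)" by (intro mult_left_mono half) simp
      also have "\<dots> = (\<integral>\<^sup>+x. ennreal (R powr e) * indicator (A - ?B) x \<partial>M)"
        using A by (simp add: nn_integral_cmult_indicator)
      also have "\<dots> \<le> (\<integral>\<^sup>+x. ennreal (\<rho> x powr e) * indicator A x \<partial>M)"
      proof (rule nn_integral_mono)
        fix x assume "x \<in> space M"
        then show "ennreal (R powr e) * indicator (A - ?B) x \<le> ennreal (\<rho> x powr e) * indicator A x"
          using R e by (auto simp: indicator_def intro!: ennreal_leI powr_mono2)
      qed
      finally show ?thesis .
    qed simp
  qed
qed

end

section \<open>Extension to \<open>L\<^sup>1 + L\<^sup>2\<close>\<close>

lemma norm_powr_2: "norm (z::'b::real_normed_vector) powr 2 = (norm z)\<^sup>2"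
  by (cases "z = 0") (auto simp: powr_numeral)

lemma L2_space_iff:
  "f \<in> Lp_space M 2 \<longleftrightarrow> f \<in> borel_measurable M \<and> integrable M (\<lambda>x. (norm (f x))\<^sup>2)"
  by (simp add: weighted_Lp_def norm_powr_2)

lemma L1_space_iff: "f \<in> Lp_space M 1 \<longleftrightarrow> integrable M f"
proof -
  have "f \<in> Lp_space M 1 \<longleftrightarrow> f \<in> borel_measurable M \<and> integrable M (\<lambda>x. norm (f x))"
    by (simp add: weighted_Lp_def)
  then show ?thesis by (metis borel_measurable_integrable integrable_norm integrable_norm_cancel)
qed

lemma L2_space_lincomb:
  assumes "f \<in> Lp_space M 2" "g \<in> Lp_space M 2"
  shows "(\<lambda>x. c * f x + d * g x) \<in> Lp_space M 2"
proof -
  have [measurable]: "f \<in> borel_measurable M" "g \<in> borel_measurable M"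
    using assms by (auto simp: L2_space_iff)
  have "integrable M (\<lambda>x. 2 * (norm c)\<^sup>2 * (norm (f x))\<^sup>2 + 2 * (norm d)\<^sup>2 * (norm (g x))\<^sup>2)"
    using assms by (auto simp: L2_space_iff)
  moreover have "(norm (c * f x + d * g x))\<^sup>2
      \<le> 2 * (norm c)\<^sup>2 * (norm (f x))\<^sup>2 + 2 * (norm d)\<^sup>2 * (norm (g x))\<^sup>2" for x
  proof -
    have "(norm (c * f x + d * g x))\<^sup>2 \<le> (norm c * norm (f x) + norm d * norm (g x))\<^sup>2"
      by (intro power_mono) (metis norm_mult norm_triangle_ineq, simp)
    also have "\<dots> \<le> 2 * (norm c * norm (f x))\<^sup>2 + 2 * (norm d * norm (g x))\<^sup>2"
      by (smt (verit) sum_squares_bound power2_sum)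
    finally show ?thesis by (simp add: power_mult_distrib)
  qed
  moreover have "0 \<le> 2 * (norm c)\<^sup>2 * (norm (f x))\<^sup>2 + 2 * (norm d)\<^sup>2 * (norm (g x))\<^sup>2" for x
    by simp
  ultimately have "integrable M (\<lambda>x. (norm (c * f x + d * g x))\<^sup>2)"
    by (intro Bochner_Integration.integrable_bound[of M
          "\<lambda>x. 2 * (norm c)\<^sup>2 * (norm (f x))\<^sup>2 + 2 * (norm d)\<^sup>2 * (norm (g x))\<^sup>2"
          "\<lambda>x. (norm (c * f x + d * g x))\<^sup>2"]) auto
  then show ?thesis by (simp add: L2_space_iff)
qed

lemma L2_space_add:
  "f \<in> Lp_space M 2 \<Longrightarrow> g \<in> Lp_space M 2 \<Longrightarrow> (\<lambda>x. f x + g x) \<in> Lp_space M 2"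
  using L2_space_lincomb[of f M g 1 1] by simp

lemma L2_space_diff:
  "f \<in> Lp_space M 2 \<Longrightarrow> g \<in> Lp_space M 2 \<Longrightarrow> (\<lambda>x. f x - g x) \<in> Lp_space M 2"
  using L2_space_lincomb[of f M g 1 "-1"] by simp

lemma L2_space_zero: "(\<lambda>_. 0) \<in> Lp_space M 2"
  by (simp add: L2_space_iff)

lemma L2_space_sum:
  assumes "finite J" "\<And>j. j \<in> J \<Longrightarrow> f j \<in> Lp_space M 2"
  shows "(\<lambda>x. \<Sum>j\<in>J. f j x) \<in> Lp_space M 2"
  using assms by (induction J) (auto simp: L2_space_zero intro!: L2_space_add)

lemma L2_space_cut:
  assumes "f \<in> Lp_space M 2" "E \<in> sets M"
  shows "(\<lambda>x. indicator E x * f x) \<in> Lp_space M 2"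
proof -
  have [measurable]: "f \<in> borel_measurable M" "E \<in> sets M" using assms by (auto simp: L2_space_iff)
  have "integrable M (\<lambda>x. (norm (indicator E x * f x))\<^sup>2)"
    by (rule Bochner_Integration.integrable_bound[of _ "\<lambda>x. (norm (f x))\<^sup>2"])
      (use assms in \<open>auto simp: L2_space_iff indicator_def\<close>)
  then show ?thesis by (simp add: L2_space_iff)
qed

lemma L1_space_cut:
  assumes "f \<in> Lp_space M 1" "E \<in> sets M"
  shows "(\<lambda>x. indicator E x * f x) \<in> Lp_space M 1"
proof -
  have f: "integrable M f" using assms by (simp add: L1_space_iff)
  then have [measurable]: "f \<in> borel_measurable M" "E \<in> sets M" using assms by auto
  have "integrable M (\<lambda>x. indicator E x * f x)"
    by (rule Bochner_Integration.integrable_bound[OF f]) (auto simp: indicator_def)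
  then show ?thesis by (simp add: L1_space_iff)
qed

lemma bounded_L1_in_L2:
  assumes f: "f \<in> Lp_space M 1" and b: "\<And>x. x \<in> space M \<Longrightarrow> norm (f x) \<le> B"
  shows "f \<in> Lp_space M 2"
proof -
  have i: "integrable M f" using f by (simp add: L1_space_iff)
  then have [measurable]: "f \<in> borel_measurable M" by auto
  have "integrable M (\<lambda>x. B * norm (f x))" using i by auto
  moreover have "norm ((norm (f x))\<^sup>2) \<le> norm (B * norm (f x))" if "x \<in> space M" for x
    using b[OF that] by (auto simp: power2_eq_square abs_mult intro!: mult_right_mono)
  ultimately have "integrable M (\<lambda>x. (norm (f x))\<^sup>2)"
    by (intro Bochner_Integration.integrable_bound[of M "\<lambda>x. B * norm (f x)" "\<lambda>x. (norm (f x))\<^sup>2"]) auto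
  then show ?thesis by (simp add: L2_space_iff)
qed

section \<open>Operators isometric on L2 and bounded from L1 to L-infinity\<close>

locale L1_L2_operator =
  fixes M :: "'x measure" and F :: "('x \<Rightarrow> complex) \<Rightarrow> ('x \<Rightarrow> complex)" and C\<^sub>0 :: real
  assumes unitary: "unitary_on_L2 M F" and C0_nonneg: "C\<^sub>0 \<ge> 0"
    and Linf: "\<And>f. f \<in> Lp_space M 1 \<Longrightarrow> f \<in> Lp_space M 2 \<Longrightarrow>
       Linf_norm M (F f) \<le> ennreal (C\<^sub>0 * (\<integral>x. norm (f x) \<partial>M))"
begin

lemma F_L2: "f \<in> Lp_space M 2 \<Longrightarrow> F f \<in> Lp_space M 2"
  using unitary by (auto simp: unitary_on_L2_def)

lemma F_measurable: "f \<in> Lp_space M 2 \<Longrightarrow> F f \<in> borel_measurable M"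
  using F_L2 by (auto simp: L2_space_iff)

lemma F_lincomb:
  "f \<in> Lp_space M 2 \<Longrightarrow> g \<in> Lp_space M 2 \<Longrightarrow>
    AE x in M. F (\<lambda>y. c * f y + d * g y) x = c * F f x + d * F g x"
  using unitary by (auto simp: unitary_on_L2_def)

lemma F_add:
  "f \<in> Lp_space M 2 \<Longrightarrow> g \<in> Lp_space M 2 \<Longrightarrow> AE x in M. F (\<lambda>y. f y + g y) x = F f x + F g x"
  using F_lincomb[of f g 1 1] by simp

lemma F_diff:
  "f \<in> Lp_space M 2 \<Longrightarrow> g \<in> Lp_space M 2 \<Longrightarrow> AE x in M. F (\<lambda>y. f y - g y) x = F f x - F g x"
  using F_lincomb[of f g 1 "-1"] by simp

lemma F_zero: "AE x in M. F (\<lambda>_. 0) x = 0"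
  using F_lincomb[OF L2_space_zero L2_space_zero, of 0 0] by simp

lemma F_sum:
  assumes "finite J" "\<And>j. j \<in> J \<Longrightarrow> f j \<in> Lp_space M 2"
  shows "AE x in M. F (\<lambda>x. \<Sum>j\<in>J. f j x) x = (\<Sum>j\<in>J. F (f j) x)"
  using assms
proof (induction J)
  case empty then show ?case using F_zero by simp
next
  case (insert i J)
  then have "AE x in M. F (\<lambda>x. \<Sum>j\<in>J. f j x) x = (\<Sum>j\<in>J. F (f j) x)" by simp
  moreover have "AE x in M. F (\<lambda>y. f i y + (\<Sum>j\<in>J. f j y)) x = F (f i) x + F (\<lambda>y. \<Sum>j\<in>J. f j y) x"
    using insert by (intro F_add L2_space_sum) auto
  ultimately show ?case using insert by (auto elim: eventually_elim2)
qed

lemma F_isometry: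
  assumes f: "f \<in> Lp_space M 2"
  shows "(\<integral>x. (norm (F f x))\<^sup>2 \<partial>M) = (\<integral>x. (norm (f x))\<^sup>2 \<partial>M)"
proof -
  have "(\<integral>x. F f x * cnj (F f x) \<partial>M) = (\<integral>x. f x * cnj (f x) \<partial>M)"
    using unitary f by (auto simp: unitary_on_L2_def)
  then have "(\<integral>x. complex_of_real ((norm (F f x))\<^sup>2) \<partial>M) = (\<integral>x. complex_of_real ((norm (f x))\<^sup>2) \<partial>M)"
    by (simp only: complex_norm_square)
  then show ?thesis by (simp only: integral_complex_of_real of_real_eq_iff)
qed

text \<open>\<open>F\<close> acts on functions rather than on classes, so independence of the
  representative has to be derived: f - g has norm 0, and by the isometry so has its
  transform.\<close>

lemma F_cong_AE:
  assumes f: "f \<in> Lp_space M 2" and g: "g \<in> Lp_space M 2" and eq: "AE x in M. f x = g x"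
  shows "AE x in M. F f x = F g x"
proof -
  let ?h = "\<lambda>y. f y - g y"
  have h: "?h \<in> Lp_space M 2" using f g by (rule L2_space_diff)
  have [measurable]: "?h \<in> borel_measurable M" using h by (simp add: L2_space_iff)
  have "(\<integral>x. (norm (?h x))\<^sup>2 \<partial>M) = (\<integral>x. 0 \<partial>M)"
    by (rule integral_cong_AE) (use eq in \<open>auto elim: eventually_mono\<close>)
  then have "(\<integral>x. (norm (F ?h x))\<^sup>2 \<partial>M) = 0" using F_isometry[OF h] by simp
  moreover have "integrable M (\<lambda>x. (norm (F ?h x))\<^sup>2)" using F_L2[OF h] by (simp add: L2_space_iff)
  ultimately have "AE x in M. (norm (F ?h x))\<^sup>2 = 0"
    by (subst (asm) integral_nonneg_eq_0_iff_AE) auto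
  with F_diff[OF f g] show ?thesis by eventually_elim simp
qed

lemma F_bound:
  assumes f: "f \<in> Lp_space M 1" "f \<in> Lp_space M 2"
  shows "AE x in M. norm (F f x) \<le> C\<^sub>0 * (\<integral>x. norm (f x) \<partial>M)"
proof -
  have "AE x in M. ennreal (norm (F f x)) \<le> Linf_norm M (F f)"
    unfolding Linf_norm_def by (rule esssup_AE)
  then show ?thesis
  proof eventually_elim
    case (elim x)
    then have "ennreal (norm (F f x)) \<le> ennreal (C\<^sub>0 * (\<integral>x. norm (f x) \<partial>M))"
      using Linf[OF f] by (rule order_trans)
    then show ?case by (subst (asm) ennreal_le_iff) (auto intro!: mult_nonneg_nonneg C0_nonneg)
  qed
qed

text \<open>The reference function \<open>h\<close> need not lie in L2, so its own transform is not
  at hand; \<open>F f\<close> and \<open>F g\<close> are compared through their L1 distances to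
  \<open>h\<close>. This gives both a Cauchy estimate for approximants of one function and a
  comparison of two approximating sequences.\<close>

lemma F_diff_bound:
  assumes f: "f \<in> Lp_space M 1" "f \<in> Lp_space M 2" and g: "g \<in> Lp_space M 1" "g \<in> Lp_space M 2"
    and h: "h \<in> Lp_space M 1"
  shows "AE x in M. norm (F f x - F g x)
    \<le> C\<^sub>0 * ((\<integral>x. norm (f x - h x) \<partial>M) + (\<integral>x. norm (g x - h x) \<partial>M))"
proof -
  let ?d = "\<lambda>y. f y - g y"
  have I: "integrable M f" "integrable M g" "integrable M h"
    using f g h by (simp_all add: L1_space_iff)
  have d: "?d \<in> Lp_space M 1" "?d \<in> Lp_space M 2"
    using f g L2_space_diff by (auto simp: L1_space_iff)
  have "(\<integral>x. norm (?d x) \<partial>M) \<le> (\<integral>x. norm (f x - h x) + norm (g x - h x) \<partial>M)"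
  proof (rule integral_mono)
    show "norm (f x - g x) \<le> norm (f x - h x) + norm (g x - h x)" for x
      by (metis norm_minus_commute norm_triangle_ineq diff_add_cancel add_diff_eq)
  qed (use I in auto)
  also have "\<dots> = (\<integral>x. norm (f x - h x) \<partial>M) + (\<integral>x. norm (g x - h x) \<partial>M)"
    using I by (intro Bochner_Integration.integral_add) auto
  finally have le: "C\<^sub>0 * (\<integral>x. norm (?d x) \<partial>M)
      \<le> C\<^sub>0 * ((\<integral>x. norm (f x - h x) \<partial>M) + (\<integral>x. norm (g x - h x) \<partial>M))"
    using C0_nonneg by (intro mult_left_mono)
  from F_bound[OF d] F_diff[OF f(2) g(2)] show ?thesis
    by eventually_elim (use le in simp)
qed

text \<open>The condition under the choice operator in \<open>L1_L2_extension\<close>. The chosen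
  value is known only through it, so what is proved about the extension must hold for every such g,
  with no control over \<open>f1\<close>, \<open>f2\<close> and \<open>u\<close>.\<close>

definition extends_to :: "('x \<Rightarrow> complex) \<Rightarrow> ('x \<Rightarrow> complex) \<Rightarrow> bool" where
  "extends_to f g \<longleftrightarrow> g \<in> borel_measurable M \<and>
        (\<exists>f1\<in>Lp_space M 1. \<exists>f2\<in>Lp_space M 2. \<exists>u.
           (AE x in M. f x = f1 x + f2 x) \<and>
           (\<forall>n::nat. u n \<in> Lp_space M 1 \<inter> Lp_space M 2) \<and>
           (\<lambda>n. \<integral>x. norm (u n x - f1 x) \<partial>M) \<longlonglongrightarrow> 0 \<and>
           (\<lambda>n. Linf_norm M (\<lambda>x. F (u n) x + F f2 x - g x)) \<longlonglongrightarrow> 0)"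

lemma truncation_tendsto_L1:
  assumes f: "f \<in> Lp_space M 1" and E: "\<And>n. E n \<in> sets M"
    and ev: "\<And>x. x \<in> space M \<Longrightarrow> eventually (\<lambda>n::nat. x \<in> E n) sequentially"
  shows "(\<lambda>n. \<integral>x. norm (indicator (E n) x * f x - f x) \<partial>M) \<longlonglongrightarrow> 0"
proof -
  have i: "integrable M f" using f by (simp add: L1_space_iff)
  note [measurable] = E
  have [measurable]: "f \<in> borel_measurable M" using i by auto
  have "(\<lambda>n. \<integral>x. norm (indicator (E n) x * f x - f x) \<partial>M) \<longlonglongrightarrow> (\<integral>x. 0 \<partial>M)"
  proof (rule integral_dominated_convergence[where w = "\<lambda>x. norm (f x)"])
    show "AE x in M. (\<lambda>n. norm (indicator (E n) x * f x - f x)) \<longlonglongrightarrow> 0"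
    proof (rule AE_I2)
      fix x assume "x \<in> space M"
      then show "(\<lambda>n. norm (indicator (E n) x * f x - f x)) \<longlonglongrightarrow> 0"
        by (intro tendsto_eventually eventually_mono[OF ev]) auto
    qed
  qed (use i in \<open>auto simp: indicator_def\<close>)
  then show ?thesis by simp
qed

lemma truncation_tendsto_L2:
  assumes f: "f \<in> Lp_space M 2" and E: "\<And>n. E n \<in> sets M"
    and ev: "\<And>x. x \<in> space M \<Longrightarrow> eventually (\<lambda>n::nat. x \<in> E n) sequentially"
  shows "(\<lambda>n. \<integral>x. (norm (indicator (E n) x * f x - f x))\<^sup>2 \<partial>M) \<longlonglongrightarrow> 0"
proof -
  note [measurable] = E
  have [measurable]: "f \<in> borel_measurable M" using f by (simp add: L2_space_iff)
  have "(\<lambda>n. \<integral>x. (norm (indicator (E n) x * f x - f x))\<^sup>2 \<partial>M) \<longlonglongrightarrow> (\<integral>x. 0 \<partial>M)"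
  proof (rule integral_dominated_convergence[where w = "\<lambda>x. (norm (f x))\<^sup>2"])
    show "AE x in M. (\<lambda>n. (norm (indicator (E n) x * f x - f x))\<^sup>2) \<longlonglongrightarrow> 0"
    proof (rule AE_I2)
      fix x assume "x \<in> space M"
      then show "(\<lambda>n. (norm (indicator (E n) x * f x - f x))\<^sup>2) \<longlonglongrightarrow> 0"
        by (intro tendsto_eventually eventually_mono[OF ev]) auto
    qed
  qed (use f in \<open>auto simp: indicator_def L2_space_iff\<close>)
  then show ?thesis by simp
qed

text \<open>Cutting \<open>f1\<close> at height n gives functions in both spaces. By
  \<open>F_diff_bound\<close> their transforms are uniformly Cauchy off a single null set, since
  only countably many pairs are compared.\<close>

lemma extension_exists:
  assumes f1: "f1 \<in> Lp_space M 1" and f2: "f2 \<in> Lp_space M 2"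
    and f: "AE x in M. f x = f1 x + f2 x"
  shows "\<exists>g. extends_to f g"
proof -
  have i1: "integrable M f1" using f1 by (simp add: L1_space_iff)
  have [measurable]: "f1 \<in> borel_measurable M" using i1 by auto
  define E where "E n = {x \<in> space M. norm (f1 x) \<le> real n}" for n :: nat
  have [measurable]: "E n \<in> sets M" for n unfolding E_def by measurable
  define u where "u n = (\<lambda>x. indicator (E n) x * f1 x)" for n :: nat
  have u1: "u n \<in> Lp_space M 1" for n using L1_space_cut[OF f1] by (simp add: u_def)
  have u2: "u n \<in> Lp_space M 2" for n
    by (rule bounded_L1_in_L2[OF u1, of _ "real n"]) (auto simp: u_def E_def indicator_def)
  define e where "e n = (\<integral>x. norm (u n x - f1 x) \<partial>M)" for n
  have e: "e \<longlonglongrightarrow> 0" unfolding e_def u_def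
  proof (rule truncation_tendsto_L1[OF f1])
    fix x assume x: "x \<in> space M"
    obtain N :: nat where "norm (f1 x) \<le> real N" using real_arch_simple by blast
    then show "eventually (\<lambda>n. x \<in> E n) sequentially"
      using x by (auto simp: E_def eventually_sequentially intro!: exI[of _ N])
  qed simp
  have [measurable]: "F (u n) \<in> borel_measurable M" for n using F_measurable[OF u2] .
  have [measurable]: "F f2 \<in> borel_measurable M" using F_measurable[OF f2] .
  \<comment> \<open>\<open>lim\<close> is total, so g is measurable on the whole space; off the
    exceptional null set it is the true limit.\<close>
  define g where "g x = lim (\<lambda>n. F (u n) x) + F f2 x" for x
  have [measurable]: "g \<in> borel_measurable M" unfolding g_def by measurable
  have "AE x in M. \<forall>n m. norm (F (u n) x - F (u m) x) \<le> C\<^sub>0 * (e n + e m)"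
    unfolding AE_all_countable e_def by (intro allI F_diff_bound u1 u2 f1)
  then have bd: "AE x in M. \<forall>n. norm (F (u n) x + F f2 x - g x) \<le> C\<^sub>0 * e n"
  proof eventually_elim
    case (elim x)
    have "Cauchy (\<lambda>n. F (u n) x)"
    proof (rule metric_CauchyI)
      fix \<epsilon> :: real assume \<epsilon>: "\<epsilon> > 0"
      have "(\<lambda>n. C\<^sub>0 * e n) \<longlonglongrightarrow> 0" using tendsto_mult[OF tendsto_const e, of C\<^sub>0] by simp
      then have "eventually (\<lambda>n. C\<^sub>0 * e n < \<epsilon> / 2) sequentially"
        using \<epsilon> by (intro order_tendstoD(2)) auto
      then obtain N where N: "\<And>n. n \<ge> N \<Longrightarrow> C\<^sub>0 * e n < \<epsilon> / 2"
        by (auto simp: eventually_sequentially)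
      have "dist (F (u m) x) (F (u n) x) < \<epsilon>" if "m \<ge> N" "n \<ge> N" for m n
      proof -
        have "norm (F (u m) x - F (u n) x) \<le> C\<^sub>0 * e m + C\<^sub>0 * e n"
          using elim by (simp add: distrib_left[symmetric])
        then show ?thesis using N[OF that(1)] N[OF that(2)] by (simp add: dist_norm)
      qed
      then show "\<exists>N. \<forall>m\<ge>N. \<forall>n\<ge>N. dist (F (u m) x) (F (u n) x) < \<epsilon>" by blast
    qed
    then have lim: "(\<lambda>n. F (u n) x) \<longlonglongrightarrow> lim (\<lambda>n. F (u n) x)"
      by (simp add: Cauchy_convergent_iff convergent_LIMSEQ_iff)
    show ?case
    proof
      fix n
      \<comment> \<open>Let m tend to infinity in the Cauchy bound: \<open>e m\<close> vanishes and
        leaves the 0.\<close>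
      have "norm (F (u n) x - lim (\<lambda>n. F (u n) x)) \<le> C\<^sub>0 * (e n + 0)"
      proof (rule LIMSEQ_le)
        show "(\<lambda>m. norm (F (u n) x - F (u m) x)) \<longlonglongrightarrow> norm (F (u n) x - lim (\<lambda>n. F (u n) x))"
          by (intro tendsto_intros lim)
        show "(\<lambda>m. C\<^sub>0 * (e n + e m)) \<longlonglongrightarrow> C\<^sub>0 * (e n + 0)" by (intro tendsto_intros e)
      qed (use elim in auto)
      then show "norm (F (u n) x + F f2 x - g x) \<le> C\<^sub>0 * e n" by (simp add: g_def)
    qed
  qed
  have "(\<lambda>n. Linf_norm M (\<lambda>x. F (u n) x + F f2 x - g x)) \<longlonglongrightarrow> 0"
  proof (rule tendsto_sandwich[OF _ _ tendsto_const])
    show "\<forall>\<^sub>F n in sequentially. Linf_norm M (\<lambda>x. F (u n) x + F f2 x - g x) \<le> ennreal (C\<^sub>0 * e n)"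
    proof (rule always_eventually, rule)
      fix n
      show "Linf_norm M (\<lambda>x. F (u n) x + F f2 x - g x) \<le> ennreal (C\<^sub>0 * e n)"
        unfolding Linf_norm_def
        by (rule esssup_I) (use bd in \<open>auto elim!: eventually_mono intro!: ennreal_leI\<close>)
    qed
    have "(\<lambda>n. ennreal (C\<^sub>0 * e n)) \<longlonglongrightarrow> ennreal (C\<^sub>0 * 0)"
      by (intro tendsto_ennrealI tendsto_intros e)
    then show "(\<lambda>n. ennreal (C\<^sub>0 * e n)) \<longlonglongrightarrow> 0" by simp
  qed simp
  with e u1 u2 f f1 f2 have "extends_to f g"
    unfolding extends_to_def e_def by (intro conjI bexI[of _ f1] bexI[of _ f2] exI[of _ u]) auto
  then show ?thesis by blast
qed

text \<open>The sets \<open>E n\<close> below keep the zero set of \<open>f\<close>, where \<open>f1\<close> and \<open>f2\<close> need not vanish,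
  so that the truncations of \<open>f1\<close> and \<open>f2\<close> converge on the whole space.\<close>

lemma extension_approximation:
  assumes g: "extends_to f g" and f [measurable]: "f \<in> borel_measurable M"
  obtains h where
    "\<And>n::nat. h n \<in> Lp_space M 2"
    "\<And>n. \<exists>B>0. \<forall>x\<in>space M. h n x = 0 \<or> (h n x = f x \<and> 1 / B \<le> norm (f x) \<and> norm (f x) \<le> B)"
    "AE x in M. (\<lambda>n. F (h n) x) \<longlonglongrightarrow> g x"
proof -
  obtain f1 f2 u where f1: "f1 \<in> Lp_space M 1" and f2: "f2 \<in> Lp_space M 2"
    and eq: "AE x in M. f x = f1 x + f2 x"
    and u: "\<And>n::nat. u n \<in> Lp_space M 1" "\<And>n::nat. u n \<in> Lp_space M 2"
    and u_lim: "(\<lambda>n. \<integral>x. norm (u n x - f1 x) \<partial>M) \<longlonglongrightarrow> 0"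
    and Fu: "(\<lambda>n. Linf_norm M (\<lambda>x. F (u n) x + F f2 x - g x)) \<longlonglongrightarrow> 0"
    using g unfolding extends_to_def by auto
  have [measurable]: "f1 \<in> borel_measurable M" using f1 by (auto simp: L1_space_iff)
  have [measurable]: "f2 \<in> borel_measurable M" using f2 by (auto simp: L2_space_iff)
  \<comment> \<open>The bound on \<open>f1\<close> puts its truncations into L2. The two-sided bound
    on f leaves only finitely many dyadic levels, as \<open>bounded_below_case\<close> requires;
    \<open>Suc n\<close> avoids division by zero at n = 0.\<close>
  define E where "E n = {x \<in> space M. norm (f1 x) \<le> real (Suc n) \<and>
      (f x = 0 \<or> 1 / real (Suc n) \<le> norm (f x) \<and> norm (f x) \<le> real (Suc n))}" for n
  have E [measurable]: "E n \<in> sets M" for n unfolding E_def by measurable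
  have ev: "eventually (\<lambda>n. x \<in> E n) sequentially" if "x \<in> space M" for x
  proof -
    obtain N :: nat where N: "max (norm (f1 x)) (max (norm (f x)) (1 / norm (f x))) \<le> real N"
      using real_arch_simple by blast
    have "x \<in> E n" if "n \<ge> N" for n
    proof -
      have "real N \<le> real (Suc n)" using that by simp
      then have "norm (f1 x) \<le> real (Suc n)" "norm (f x) \<le> real (Suc n)" "1 / norm (f x) \<le> real (Suc n)"
        using N by linarith+
      then show ?thesis using \<open>x \<in> space M\<close> unfolding E_def
        by (cases "f x = 0") (auto simp: field_simps simp del: of_nat_Suc)
    qed
    then show ?thesis by (auto simp: eventually_sequentially)
  qed
  define v where "v n = (\<lambda>x. indicator (E n) x * f1 x)" for n
  define w where "w n = (\<lambda>x. indicator (E n) x * f2 x)" for n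
  define h where "h n = (\<lambda>x. indicator (E n) x * f x)" for n
  have v1: "v n \<in> Lp_space M 1" for n using L1_space_cut[OF f1] by (simp add: v_def)
  have v2: "v n \<in> Lp_space M 2" for n
    by (rule bounded_L1_in_L2[OF v1, of _ "real (Suc n)"]) (auto simp: v_def E_def indicator_def)
  have w2: "w n \<in> Lp_space M 2" for n using L2_space_cut[OF f2] by (simp add: w_def)
  have h_eq: "AE x in M. v n x + w n x = h n x" for n
    using eq by (auto elim!: eventually_mono simp: v_def w_def h_def distrib_left)
  have h2: "h n \<in> Lp_space M 2" for n
  proof -
    have vw: "(\<lambda>x. v n x + w n x) \<in> Lp_space M 2" by (intro L2_space_add v2 w2)
    have [measurable]: "h n \<in> borel_measurable M" "(\<lambda>x. v n x + w n x) \<in> borel_measurable M"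
      by (simp_all add: h_def v_def w_def)
    have "integrable M (\<lambda>x. (norm (h n x))\<^sup>2) \<longleftrightarrow> integrable M (\<lambda>x. (norm (v n x + w n x))\<^sup>2)"
      by (rule integrable_cong_AE) (use h_eq[of n] in \<open>auto elim!: eventually_mono\<close>)
    then show ?thesis using vw by (simp add: L2_space_iff)
  qed
  have Fh: "AE x in M. F (h n) x = F (v n) x + F (w n) x" for n
    using F_cong_AE[OF L2_space_add[OF v2 w2] h2 h_eq, of n] F_add[OF v2 w2, of n n]
    by eventually_elim simp
  \<comment> \<open>The truncations of \<open>f2\<close> converge in L2, and the isometry carries
    this over to their transforms.\<close>
  have "(\<lambda>n. \<integral>x. (norm (F (w n) x - F f2 x))\<^sup>2 \<partial>M) \<longlonglongrightarrow> 0"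
  proof -
    have "(\<integral>x. (norm (F (w n) x - F f2 x))\<^sup>2 \<partial>M) = (\<integral>x. (norm (w n x - f2 x))\<^sup>2 \<partial>M)" for n
    proof -
      have d: "(\<lambda>x. w n x - f2 x) \<in> Lp_space M 2" by (intro L2_space_diff w2 f2)
      have [measurable]: "F (w n) \<in> borel_measurable M" "F f2 \<in> borel_measurable M"
        "F (\<lambda>x. w n x - f2 x) \<in> borel_measurable M"
        using F_measurable w2 f2 d by blast+
      have "(\<integral>x. (norm (F (w n) x - F f2 x))\<^sup>2 \<partial>M) = (\<integral>x. (norm (F (\<lambda>x. w n x - f2 x) x))\<^sup>2 \<partial>M)"
        by (rule integral_cong_AE) (use F_diff[OF w2 f2, of n] in \<open>auto elim!: eventually_mono\<close>)
      then show ?thesis using F_isometry[OF d] by simp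
    qed
    moreover have "(\<lambda>n. \<integral>x. (norm (w n x - f2 x))\<^sup>2 \<partial>M) \<longlonglongrightarrow> 0"
      unfolding w_def by (rule truncation_tendsto_L2[OF f2 E ev])
    ultimately show ?thesis by simp
  qed
  moreover have "integrable M (\<lambda>x. (norm (F (w n) x - F f2 x))\<^sup>2)" for n
    using L2_space_diff[OF F_L2[OF w2] F_L2[OF f2]] by (simp add: L2_space_iff)
  \<comment> \<open>Convergence in L2 gives convergence almost everywhere only along a subsequence,
    so the sequence finally returned is h composed with r.\<close>
  ultimately obtain r :: "nat \<Rightarrow> nat" where r: "strict_mono r"
    and lim_w: "AE x in M. (\<lambda>n. (norm (F (w (r n)) x - F f2 x))\<^sup>2) \<longlonglongrightarrow> 0"
    using tendsto_L1_AE_subseq[of M "\<lambda>n x. (norm (F (w n) x - F f2 x))\<^sup>2"] by auto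
  have v_lim: "(\<lambda>n. \<integral>x. norm (v n x - f1 x) \<partial>M) \<longlonglongrightarrow> 0"
    unfolding v_def by (rule truncation_tendsto_L1[OF f1 E ev])
  \<comment> \<open>\<open>u\<close> comes with the chosen extension and is unrelated to the
    truncations \<open>v\<close>. Both tend to \<open>f1\<close> in L1, so their transforms differ
    by something that tends uniformly to 0.\<close>
  have vu: "AE x in M. \<forall>n. norm (F (v n) x - F (u n) x)
      \<le> C\<^sub>0 * ((\<integral>x. norm (v n x - f1 x) \<partial>M) + (\<integral>x. norm (u n x - f1 x) \<partial>M))"
    unfolding AE_all_countable by (intro allI F_diff_bound v1 v2 u f1)
  have ug: "AE x in M. \<forall>n. ennreal (norm (F (u n) x + F f2 x - g x))
      \<le> Linf_norm M (\<lambda>x. F (u n) x + F f2 x - g x)"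
    unfolding AE_all_countable Linf_norm_def by (intro allI esssup_AE)
  have Fh_all: "AE x in M. \<forall>n. F (h n) x = F (v n) x + F (w n) x"
    unfolding AE_all_countable using Fh by blast
  have conv: "AE x in M. (\<lambda>n. F (h (r n)) x) \<longlonglongrightarrow> g x"
    using lim_w vu ug Fh_all
  proof eventually_elim
    case (elim x)
    have A: "(\<lambda>n. F (v n) x - F (u n) x) \<longlonglongrightarrow> 0"
    proof (rule Lim_null_comparison)
      show "\<forall>\<^sub>F n in sequentially. norm (F (v n) x - F (u n) x)
         \<le> C\<^sub>0 * ((\<integral>x. norm (v n x - f1 x) \<partial>M) + (\<integral>x. norm (u n x - f1 x) \<partial>M))"
        using elim(2) by simp
      show "(\<lambda>n. C\<^sub>0 * ((\<integral>x. norm (v n x - f1 x) \<partial>M) + (\<integral>x. norm (u n x - f1 x) \<partial>M))) \<longlonglongrightarrow> 0"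
        using tendsto_mult[OF tendsto_const tendsto_add[OF v_lim u_lim], of C\<^sub>0] by simp
    qed
    have B: "(\<lambda>n. F (u n) x + F f2 x - g x) \<longlonglongrightarrow> 0"
    proof -
      have "(\<lambda>n. ennreal (norm (F (u n) x + F f2 x - g x))) \<longlonglongrightarrow> 0"
        by (rule tendsto_sandwich[OF _ _ tendsto_const Fu]) (use elim(3) in auto)
      then have "(\<lambda>n. ennreal (norm (F (u n) x + F f2 x - g x))) \<longlonglongrightarrow> ennreal 0" by simp
      then have "(\<lambda>n. norm (F (u n) x + F f2 x - g x)) \<longlonglongrightarrow> 0"
        by (subst (asm) tendsto_ennreal_iff) auto
      then show ?thesis by (rule tendsto_norm_zero_cancel)
    qed
    have W: "(\<lambda>n. F (w (r n)) x - F f2 x) \<longlonglongrightarrow> 0"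
    proof -
      have "(\<lambda>n. sqrt ((norm (F (w (r n)) x - F f2 x))\<^sup>2)) \<longlonglongrightarrow> sqrt 0"
        using elim(1) by (intro tendsto_intros)
      then have "(\<lambda>n. norm (F (w (r n)) x - F f2 x)) \<longlonglongrightarrow> 0" by simp
      then show ?thesis by (rule tendsto_norm_zero_cancel)
    qed
    \<comment> \<open>The terms telescope to \<open>F (v (r n)) x + F (w (r n)) x\<close>, which is
      the transform of \<open>h (r n)\<close>.\<close>
    have "(\<lambda>n. (F (v (r n)) x - F (u (r n)) x) + (F (u (r n)) x + F f2 x - g x)
        + (F (w (r n)) x - F f2 x) + g x) \<longlonglongrightarrow> 0 + 0 + 0 + g x"
      using LIMSEQ_subseq_LIMSEQ[OF A r] LIMSEQ_subseq_LIMSEQ[OF B r] W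
      by (intro tendsto_intros) (simp_all add: o_def)
    moreover have "(F (v (r n)) x - F (u (r n)) x) + (F (u (r n)) x + F f2 x - g x)
        + (F (w (r n)) x - F f2 x) + g x = F (h (r n)) x" for n
      using elim(4) by simp
    ultimately show ?case by simp
  qed
  have hb: "\<exists>B>0. \<forall>x\<in>space M. h n x = 0 \<or> (h n x = f x \<and> 1 / B \<le> norm (f x) \<and> norm (f x) \<le> B)" for n
    by (rule exI[of _ "real (Suc n)"]) (auto simp: h_def E_def indicator_def simp del: of_nat_Suc)
  show ?thesis
    by (rule that[of "\<lambda>n. h (r n)"]) (use h2 hb conv in auto)
qed

end

section \<open>Pitt's inequality\<close>

lemma sum_geometric_le:
  fixes r :: real
  assumes "finite A" "0 \<le> r" "r < 1"
  shows "(\<Sum>k\<in>A. r ^ k) \<le> 1 / (1 - r)"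
  using sum_le_suminf[of "\<lambda>k. r ^ k" A] suminf_geometric[of r] summable_geometric[of r] assms
  by simp

text \<open>Gaps among the exponents only help, and b \<ge> 2 bounds 1 / (1 - 1 / b) by 2. The case
  b = 2 serves the L1 norm of a piece, b = 4 its squared L2 norm.\<close>

lemma sum_powr_le_Max:
  fixes b :: real and G :: "int set"
  assumes "finite G" "G \<noteq> {}" "b \<ge> 2"
  shows "(\<Sum>n\<in>G. b powr of_int n) \<le> 2 * b powr of_int (Max G)"
proof -
  let ?k = "\<lambda>n. nat (Max G - n)"
  have le: "n \<le> Max G" if "n \<in> G" for n using that assms by simp
  have inj: "inj_on ?k G"
  proof (rule inj_onI)
    fix x y assume "x \<in> G" "y \<in> G" "?k x = ?k y"
    then show "x = y" using le[of x] le[of y] by simp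
  qed
  have "(\<Sum>n\<in>G. b powr of_int n) = (\<Sum>n\<in>G. b powr of_int (Max G) * (1 / b) ^ ?k n)"
  proof (rule sum.cong[OF refl])
    fix n assume "n \<in> G"
    then have k: "real (?k n) = of_int (Max G) - of_int n" using le[of n] by simp
    have "(1 / b) ^ ?k n = b powr - real (?k n)"
      using assms by (simp add: powr_minus powr_realpow power_inverse divide_inverse)
    then show "b powr of_int n = b powr of_int (Max G) * (1 / b) ^ ?k n"
      unfolding k by (simp add: powr_add[symmetric])
  qed
  also have "\<dots> = b powr of_int (Max G) * (\<Sum>k\<in>?k ` G. (1 / b) ^ k)"
    using inj by (simp add: sum.reindex sum_distrib_left)
  also have "\<dots> \<le> b powr of_int (Max G) * (1 / (1 - 1 / b))"
    using assms by (intro mult_left_mono sum_geometric_le) auto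
  also have "\<dots> \<le> b powr of_int (Max G) * 2"
    using assms by (intro mult_left_mono) (auto simp: field_simps)
  finally show ?thesis by simp
qed

text \<open>The point is uniformity in J and in the position -z of the peak. On each side of the
  peak the integers are re-indexed by natural numbers not exceeding the distance to it; the shift by
  1 in \<open>?m\<close> absorbs the fractional part of z.\<close>

lemma sum_tent_le:
  fixes z \<epsilon> :: real and J :: "int set"
  assumes J: "finite J" and "\<epsilon> > 0"
  shows "(\<Sum>j\<in>J. 2 powr (- \<epsilon> * \<bar>of_int j + z\<bar>)) \<le> 2 / (1 - 2 powr - \<epsilon>)"
proof -
  define r where "r = 2 powr - \<epsilon>"
  have r: "0 \<le> r" "r < 1" using powr_less_mono[of "- \<epsilon>" 0 2] \<open>\<epsilon> > 0\<close> by (simp_all add: r_def)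
  let ?P = "{j \<in> J. j + \<lfloor>z\<rfloor> \<ge> 0}" and ?N = "{j \<in> J. \<not> j + \<lfloor>z\<rfloor> \<ge> 0}"
  let ?k = "\<lambda>j. nat (j + \<lfloor>z\<rfloor>)" and ?m = "\<lambda>j. nat (- (j + \<lfloor>z\<rfloor> + 1))"
  have rp: "r ^ n = 2 powr (- \<epsilon> * real n)" for n
    by (simp add: r_def powr_realpow[symmetric] powr_powr)
  have fl: "of_int \<lfloor>z\<rfloor> \<le> z" "z < of_int \<lfloor>z\<rfloor> + 1" by linarith+
  have "(\<Sum>j\<in>?P. 2 powr (- \<epsilon> * \<bar>of_int j + z\<bar>)) \<le> (\<Sum>j\<in>?P. r ^ ?k j)"
  proof (rule sum_mono)
    fix j assume "j \<in> ?P"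
    then have "real (?k j) = of_int j + of_int \<lfloor>z\<rfloor>" by simp
    then have "real (?k j) \<le> \<bar>of_int j + z\<bar>" using fl by linarith
    then show "2 powr (- \<epsilon> * \<bar>of_int j + z\<bar>) \<le> r ^ ?k j"
      unfolding rp using \<open>\<epsilon> > 0\<close> by (intro powr_mono) auto
  qed
  also have "\<dots> = (\<Sum>k\<in>?k ` ?P. r ^ k)"
    by (subst sum.reindex) (auto simp: inj_on_def)
  also have "\<dots> \<le> 1 / (1 - r)" using J r by (intro sum_geometric_le) auto
  finally have 1: "(\<Sum>j\<in>?P. 2 powr (- \<epsilon> * \<bar>of_int j + z\<bar>)) \<le> 1 / (1 - r)" .
  have "(\<Sum>j\<in>?N. 2 powr (- \<epsilon> * \<bar>of_int j + z\<bar>)) \<le> (\<Sum>j\<in>?N. r ^ ?m j)"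
  proof (rule sum_mono)
    fix j assume "j \<in> ?N"
    then have j: "j + \<lfloor>z\<rfloor> + 1 \<le> 0" by simp
    then have "real (?m j) = - (of_int j + of_int \<lfloor>z\<rfloor> + 1)" by simp
    then have "real (?m j) \<le> \<bar>of_int j + z\<bar>" using fl by linarith
    then show "2 powr (- \<epsilon> * \<bar>of_int j + z\<bar>) \<le> r ^ ?m j"
      unfolding rp using \<open>\<epsilon> > 0\<close> by (intro powr_mono) auto
  qed
  also have "\<dots> = (\<Sum>k\<in>?m ` ?N. r ^ k)"
    by (subst sum.reindex) (auto simp: inj_on_def)
  also have "\<dots> \<le> 1 / (1 - r)" using J r by (intro sum_geometric_le) auto
  finally have 2: "(\<Sum>j\<in>?N. 2 powr (- \<epsilon> * \<bar>of_int j + z\<bar>)) \<le> 1 / (1 - r)" .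
  have "(\<Sum>j\<in>J. 2 powr (- \<epsilon> * \<bar>of_int j + z\<bar>))
      = (\<Sum>j\<in>?P. 2 powr (- \<epsilon> * \<bar>of_int j + z\<bar>)) + (\<Sum>j\<in>?N. 2 powr (- \<epsilon> * \<bar>of_int j + z\<bar>))"
    using J by (subst sum.union_disjoint[symmetric]) (auto intro!: sum.cong)
  also have "\<dots> \<le> 2 / (1 - r)" using 1 2 by simp
  finally show ?thesis by (simp add: r_def)
qed

text \<open>Hoelder's inequality with weights, obtained from convexity of the q-th power at the
  points x j / c j with masses c j / S.\<close>

lemma sum_powr_le_weighted:
  fixes c x :: "'i \<Rightarrow> real"
  assumes "finite J" and c: "\<And>j. j \<in> J \<Longrightarrow> c j > 0" and x: "\<And>j. j \<in> J \<Longrightarrow> x j \<ge> 0" and q: "q \<ge> 1"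
  shows "(\<Sum>j\<in>J. x j) powr q \<le> (\<Sum>j\<in>J. c j) powr (q - 1) * (\<Sum>j\<in>J. c j powr (1 - q) * x j powr q)"
proof -
  \<comment> \<open>Zero terms are dropped so that convexity is applied at positive points
    only.\<close>
  define I where "I = {j \<in> J. x j > 0}"
  have I: "finite I" "I \<subseteq> J" using assms by (auto simp: I_def)
  have "(\<Sum>j\<in>J. x j) = (\<Sum>j\<in>I. x j)"
    using assms by (intro sum.mono_neutral_right) (auto simp: I_def not_less intro: antisym)
  moreover have "(\<Sum>j\<in>I. x j) powr q
     \<le> (\<Sum>j\<in>J. c j) powr (q - 1) * (\<Sum>j\<in>J. c j powr (1 - q) * x j powr q)"
  proof (cases "I = {}")
    case True
    have "0 \<le> (\<Sum>j\<in>J. c j powr (1 - q) * x j powr q)" by (intro sum_nonneg) auto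
    with True show ?thesis by simp
  next
    case False
    define S where "S = (\<Sum>j\<in>I. c j)"
    have S: "S > 0" unfolding S_def using I False c by (intro sum_pos) auto
    have SJ: "S \<le> (\<Sum>j\<in>J. c j)"
      unfolding S_def using assms(1) I c by (intro sum_mono2) (auto intro: less_imp_le)
    have xc: "x j > 0" "c j > 0" if "j \<in> I" for j using that c by (auto simp: I_def)
    have "(\<Sum>j\<in>I. (c j / S) *\<^sub>R (x j / c j)) powr q \<le> (\<Sum>j\<in>I. c j / S * (x j / c j) powr q)"
    proof (rule convex_on_sum[OF I(1) False powr_convex[OF q]])
      show "(\<Sum>j\<in>I. c j / S) = 1" using S by (simp add: S_def sum_divide_distrib[symmetric])
    qed (use S xc in \<open>auto intro: less_imp_le\<close>)
    also have "(\<Sum>j\<in>I. (c j / S) *\<^sub>R (x j / c j)) = (\<Sum>j\<in>I. x j) / S"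
      using xc(2) by (simp add: sum_divide_distrib) (intro sum.cong refl, force)
    also have "(\<Sum>j\<in>I. c j / S * (x j / c j) powr q) = (\<Sum>j\<in>I. c j powr (1 - q) * x j powr q) / S"
      unfolding sum_divide_distrib
    proof (rule sum.cong[OF refl])
      fix j assume j: "j \<in> I"
      show "c j / S * (x j / c j) powr q = c j powr (1 - q) * x j powr q / S"
        using xc[OF j] by (simp add: powr_divide powr_diff)
    qed
    finally have "((\<Sum>j\<in>I. x j) / S) powr q * S powr q
        \<le> (\<Sum>j\<in>I. c j powr (1 - q) * x j powr q) / S * S powr q"
      by (intro mult_right_mono) auto
    moreover have "((\<Sum>j\<in>I. x j) / S) powr q * S powr q = (\<Sum>j\<in>I. x j) powr q"
      using S xc(1) by (simp add: powr_divide sum_nonneg less_imp_le)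
    moreover have "(\<Sum>j\<in>I. c j powr (1 - q) * x j powr q) / S * S powr q
        = S powr (q - 1) * (\<Sum>j\<in>I. c j powr (1 - q) * x j powr q)"
      using S by (simp add: powr_diff)
    moreover have "\<dots> \<le> (\<Sum>j\<in>J. c j) powr (q - 1) * (\<Sum>j\<in>J. c j powr (1 - q) * x j powr q)"
      using S SJ q I assms(1)
      by (intro mult_mono powr_mono2 sum_mono2 sum_nonneg) auto
    ultimately show ?thesis by linarith
  qed
  ultimately show ?thesis by simp
qed

text \<open>The embedding of l^1 into l^r: of the r factors in each term, all but one are estimated
  by the total.\<close>

lemma sum_powr_le_powr_sum:
  fixes a :: "'i \<Rightarrow> real"
  assumes "finite J" and a: "\<And>j. j \<in> J \<Longrightarrow> a j \<ge> 0" and r: "r \<ge> 1"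
  shows "(\<Sum>j\<in>J. a j powr r) \<le> (\<Sum>j\<in>J. a j) powr r"
proof -
  let ?T = "\<Sum>j\<in>J. a j"
  have split: "y powr r = y * y powr (r - 1)" if "y \<ge> 0" for y :: real
    using that powr_mult_base[of y "r - 1"] by simp
  have "(\<Sum>j\<in>J. a j powr r) \<le> (\<Sum>j\<in>J. a j * ?T powr (r - 1))"
  proof (rule sum_mono)
    fix j assume j: "j \<in> J"
    have "a j \<le> ?T" using j assms by (intro member_le_sum) auto
    then show "a j powr r \<le> a j * ?T powr (r - 1)"
      using a[OF j] r by (subst split) (auto intro!: mult_left_mono powr_mono2)
  qed
  also have "\<dots> = ?T powr r" using a by (subst split) (auto simp: sum_distrib_right sum_nonneg)
  finally show ?thesis .
qed

section \<open>The exponents, and the transform of a single piece\<close>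

locale pitt_setting = gauge_space M \<rho> D K + L1_L2_operator M F C\<^sub>0
  for M :: "'x measure" and \<rho> D K F C\<^sub>0 +
  fixes p q \<alpha> l :: real
  assumes p_gt: "1 < p" and p_le_q: "p \<le> q" and alpha_neg: "\<alpha> < 0" and l_pos: "l > 0"
    and alpha_gt: "\<alpha> > - D / q" and exponents: "(\<alpha> + l) / D = 1 - 1 / p - 1 / q"
begin

lemma q_gt: "1 < q" using p_gt p_le_q by simp

lemma l_eq: "l = D * (1 - 1 / p - 1 / q) - \<alpha>"
  using exponents D_pos by (simp add: field_simps)

lemma neg_alpha_q: "0 < - \<alpha> * q" "- \<alpha> * q < D"
  using alpha_neg alpha_gt q_gt by (auto simp: field_simps mult_less_0_iff)

lemma inverse_exponent: "1 / p + l / D = 1 - 1 / q - \<alpha> / D"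
  using exponents D_pos by (simp add: field_simps)

text \<open>This is the condition under which the power 2 / (2 - q) of \<rho>^(\<alpha> q) is
  integrable at infinity, so that Hoelder's inequality against L2 can work far out. It holds because
  p \<le> q < 2 forces 1 / p > 1 / 2, while l > 0.\<close>

lemma neg_alpha_q_gt:
  assumes "q < 2"
  shows "(1 - q / 2) * D < - \<alpha> * q"
proof -
  have "1 / 2 < 1 / p" using assms p_le_q p_gt by (intro divide_strict_left_mono) auto
  then have "1 / 2 < 1 - 1 / q - \<alpha> / D" using inverse_exponent l_pos D_pos by (smt (verit) divide_pos_pos)
  then have "q * D * (1 / 2) < q * D * (1 - 1 / q - \<alpha> / D)"
    using q_gt D_pos by (intro mult_strict_left_mono) auto
  also have "\<dots> = q * D - D - \<alpha> * q" using q_gt D_pos by (simp add: field_simps)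
  finally show ?thesis by (simp add: field_simps)
qed

text \<open>Only on L1 + L2 does the extension carry information. Everything near the origin goes to
  L1, together with the places where |f| is at most the weighted integrand; what remains is far out
  and small enough for L2.\<close>

lemma in_L1_plus_L2:
  assumes f [measurable]: "f \<in> borel_measurable M"
    and S: "integrable M (\<lambda>x. norm (f x) powr p * \<rho> x powr (l * p))"
  obtains f1 f2 :: "'x \<Rightarrow> complex" where "f1 \<in> Lp_space M 1" "f2 \<in> Lp_space M 2"
    "\<And>x. x \<in> space M \<Longrightarrow> f x = f1 x + f2 x"
proof -
  let ?w = "\<lambda>x. norm (f x) powr p * \<rho> x powr (l * p)"
  define A where "A = {x \<in> space M. \<rho> x < 1}"
  define E where "E = {x \<in> space M. \<rho> x < 1 \<or> norm (f x) powr (p - 1) * \<rho> x powr (l * p) \<ge> 1}"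
  have [measurable]: "A \<in> sets M" "E \<in> sets M" unfolding A_def E_def by measurable
  \<comment> \<open>Where |f|^(p-1) \<rho>^(l p) < 1, the function is below \<rho>^e. Integrability
    near the origin means l < D (1 - 1/p), which follows from \<alpha> > -D/q and the balance of
    exponents.\<close>
  define e where "e = - (l * p) / (p - 1)"
  have e: "e > - D"
  proof -
    have "D * (1 - 1 / p - 1 / q) = D * (1 - 1 / p) - D / q" by (simp add: algebra_simps)
    then have "l < D * (1 - 1 / p)" using l_eq alpha_gt by linarith
    then have "l * p < D * (1 - 1 / p) * p" using p_gt by (intro mult_strict_right_mono) auto
    also have "\<dots> = D * (p - 1)" using p_gt by (simp add: field_simps)
    finally show ?thesis using p_gt by (simp add: e_def field_simps)
  qed
  obtain Cn where Cn: "\<And>R. R > 0 \<Longrightarrow> (\<integral>\<^sup>+x. ennreal (\<rho> x powr e) * indicator {x \<in> space M. \<rho> x < R} x \<partial>M)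
        \<le> ennreal (Cn * R powr (e + D))"
    using near_power_integral[OF e] by blast
  have in_near: "integrable M (\<lambda>x. \<rho> x powr e * indicator A x)"
  proof (rule integrableI_bounded)
    have "(\<integral>\<^sup>+x. ennreal (norm (\<rho> x powr e * indicator A x)) \<partial>M) \<le> ennreal Cn"
      using Cn[of 1] by (simp add: A_def ennreal_mult' ennreal_indicator)
    then show "(\<integral>\<^sup>+x. ennreal (norm (\<rho> x powr e * indicator A x)) \<partial>M) < \<infinity>"
      using le_less_trans ennreal_less_top by (metis infinity_ennreal_def)
  qed simp
  \<comment> \<open>One exponent covers both cases. For p \<le> 2 the first summand suffices and -D
    - 1 is just an admissible value; for p > 2 the second summand is y^2 at the threshold y^(p-2)
    r^(l p) = 1.\<close>
  have "\<exists>e2 < - D. \<forall>y r::real. 0 \<le> y \<longrightarrow> 1 \<le> r \<longrightarrow> y powr (p - 1) * r powr (l * p) < 1 \<longrightarrow>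
      y\<^sup>2 \<le> y powr p * r powr (l * p) + r powr e2"
  proof (cases "p \<le> 2")
    case True
    show ?thesis
    proof (intro exI[of _ "- D - 1"] conjI allI impI)
      fix y r :: real assume y: "0 \<le> y" "1 \<le> r" "y powr (p - 1) * r powr (l * p) < 1"
      have r: "1 \<le> r powr (l * p)" using y l_pos p_gt by (intro ge_one_powr_ge_zero) auto
      have "y \<le> 1"
      proof (rule ccontr)
        assume "\<not> y \<le> 1"
        then have "1 \<le> y powr (p - 1)" using p_gt by (intro ge_one_powr_ge_zero) auto
        then have "1 * 1 \<le> y powr (p - 1) * r powr (l * p)" using r by (intro mult_mono) auto
        then show False using y by simp
      qed
      have "y\<^sup>2 \<le> y powr p"
      proof (cases "y = 0")
        case False
        then have "y\<^sup>2 = y powr 2" using y by (simp add: powr_numeral)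
        also have "\<dots> \<le> y powr p" using True y \<open>y \<le> 1\<close> by (intro powr_mono') auto
        finally show ?thesis .
      qed simp
      also have "\<dots> \<le> y powr p * r powr (l * p)" using r by (simp add: mult_le_cancel_left1)
      finally show "y\<^sup>2 \<le> y powr p * r powr (l * p) + r powr (- D - 1)"
        by (rule order_trans) simp
    qed simp
  next
    case False
    \<comment> \<open>Here p \<le> q and the sign of \<alpha> enter: with 1/q \<le> 1/p the balance
      of exponents gives l > D (1 - 2/p).\<close>
    have lt: "- 2 * (l * p) / (p - 2) < - D"
    proof -
      have "1 / q \<le> 1 / p" using p_le_q p_gt by (intro divide_left_mono) auto
      then have "D * (1 - 2 / p) \<le> D * (1 - 1 / p - 1 / q)" using D_pos by (intro mult_left_mono) auto
      then have "D * (1 - 2 / p) < l" using l_eq alpha_neg by linarith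
      then have "D * (1 - 2 / p) * p < l * p" using p_gt by (intro mult_strict_right_mono) auto
      moreover have "D * (1 - 2 / p) * p = D * (p - 2)" using p_gt by (simp add: field_simps)
      moreover have "0 < l * p" using l_pos p_gt by simp
      ultimately have "D * (p - 2) < 2 * (l * p)" by linarith
      then show ?thesis using False by (simp add: field_simps)
    qed
    show ?thesis
    proof (intro exI[of _ "- 2 * (l * p) / (p - 2)"] conjI allI impI lt)
      fix y r :: real assume y: "0 \<le> y" "1 \<le> r"
      show "y\<^sup>2 \<le> y powr p * r powr (l * p) + r powr (- 2 * (l * p) / (p - 2))"
      proof (cases "y = 0")
        case True then show ?thesis by simp
      next
        case False
        then have y0: "y > 0" using y by simp
        have y2: "y\<^sup>2 = y powr 2" using y0 by (simp add: powr_numeral)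
        show ?thesis
        proof (cases "y powr (p - 2) * r powr (l * p) \<ge> 1")
          case True
          have "y\<^sup>2 * 1 \<le> y powr 2 * (y powr (p - 2) * r powr (l * p))"
            unfolding y2 using True by (intro mult_left_mono) auto
          also have "\<dots> = y powr p * r powr (l * p)"
            by (simp add: powr_add[symmetric] mult.assoc[symmetric])
          finally show ?thesis by (smt (verit) powr_ge_zero)
        next
          case lt1: False
          have "y powr (p - 2) < r powr (- (l * p))"
            using lt1 y by (simp add: powr_minus field_simps)
          then have "(y powr (p - 2)) powr (2 / (p - 2)) \<le> (r powr (- (l * p))) powr (2 / (p - 2))"
            using \<open>\<not> p \<le> 2\<close> by (intro powr_mono2) auto
          moreover have "(p - 2) * (2 / (p - 2)) = 2" using \<open>\<not> p \<le> 2\<close> by (simp add: divide_eq_eq)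
          moreover have "- (l * p) * (2 / (p - 2)) = - 2 * (l * p) / (p - 2)" by simp
          ultimately have "y\<^sup>2 \<le> r powr (- 2 * (l * p) / (p - 2))"
            unfolding y2 powr_powr by metis
          then show ?thesis by (smt (verit) mult_nonneg_nonneg powr_ge_zero)
        qed
      qed
    qed
  qed
  then obtain e2 where e2: "e2 < - D"
    and far: "\<And>y r::real. 0 \<le> y \<Longrightarrow> 1 \<le> r \<Longrightarrow> y powr (p - 1) * r powr (l * p) < 1 \<Longrightarrow>
      y\<^sup>2 \<le> y powr p * r powr (l * p) + r powr e2"
    by blast
  obtain Cf where Cf: "\<And>R. R > 0 \<Longrightarrow> (\<integral>\<^sup>+x. ennreal (\<rho> x powr e2) * indicator {x \<in> space M. R \<le> \<rho> x} x \<partial>M)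
        \<le> ennreal (Cf * R powr (e2 + D))"
    using far_power_integral[OF e2] by blast
  define B where "B = {x \<in> space M. 1 \<le> \<rho> x}"
  have [measurable]: "B \<in> sets M" unfolding B_def by measurable
  have in_far: "integrable M (\<lambda>x. \<rho> x powr e2 * indicator B x)"
  proof (rule integrableI_bounded)
    have "(\<integral>\<^sup>+x. ennreal (norm (\<rho> x powr e2 * indicator B x)) \<partial>M) \<le> ennreal Cf"
      using Cf[of 1] by (simp add: B_def ennreal_mult' ennreal_indicator)
    then show "(\<integral>\<^sup>+x. ennreal (norm (\<rho> x powr e2 * indicator B x)) \<partial>M) < \<infinity>"
      using le_less_trans ennreal_less_top by (metis infinity_ennreal_def)
  qed simp
  define f1 where "f1 x = (if x \<in> E then f x else 0)" for x
  define f2 where "f2 x = (if x \<in> E then 0 else f x)" for x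
  have [measurable]: "f1 \<in> borel_measurable M" "f2 \<in> borel_measurable M"
    unfolding f1_def f2_def by measurable
  have yp: "y powr p = y * y powr (p - 1)" if "y \<ge> 0" for y :: real
    using that powr_mult_base[of y "p - 1"] by simp
  have "integrable M f1"
  proof (rule Bochner_Integration.integrable_bound)
    show "integrable M (\<lambda>x. ?w x + \<rho> x powr e * indicator A x)"
      using S in_near by (rule Bochner_Integration.integrable_add)
    show "AE x in M. norm (f1 x) \<le> norm (?w x + \<rho> x powr e * indicator A x)"
      using rho_pos
    proof eventually_elim
      case (elim x)
      have "norm (f1 x) \<le> ?w x + \<rho> x powr e * indicator A x"
      proof (cases "norm (f x) powr (p - 1) * \<rho> x powr (l * p) \<ge> 1")
        case True
        then have "norm (f x) * 1 \<le> norm (f x) * (norm (f x) powr (p - 1) * \<rho> x powr (l * p))"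
          by (intro mult_left_mono) auto
        also have "\<dots> = ?w x" using yp[of "norm (f x)"] by simp
        finally have "norm (f x) \<le> ?w x" by simp
        moreover have "0 \<le> \<rho> x powr e * indicator A x" by simp
        moreover have "norm (f1 x) \<le> norm (f x)" by (simp add: f1_def)
        ultimately show ?thesis by linarith
      next
        case False
        have w0: "0 \<le> ?w x" by simp
        show ?thesis
        proof (cases "x \<in> E")
          case True
          then have xA: "x \<in> A" using False by (auto simp: E_def A_def)
          have "norm (f x) powr (p - 1) < \<rho> x powr (- (l * p))"
            using False elim by (simp add: powr_minus field_simps)
          then have "(norm (f x) powr (p - 1)) powr (1 / (p - 1))
              \<le> (\<rho> x powr (- (l * p))) powr (1 / (p - 1))"
            using p_gt by (intro powr_mono2) auto
          then have "norm (f x) \<le> \<rho> x powr e"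
            using p_gt unfolding powr_powr e_def by simp
          moreover have "norm (f1 x) = norm (f x)" "\<rho> x powr e * indicator A x = \<rho> x powr e"
            using True xA by (simp_all add: f1_def)
          ultimately show ?thesis using w0 by linarith
        qed (use w0 in \<open>simp add: f1_def\<close>)
      qed
      then show ?case by (simp only: real_norm_def)
    qed
  qed simp
  moreover have "integrable M (\<lambda>x. (norm (f2 x))\<^sup>2)"
  proof (rule Bochner_Integration.integrable_bound)
    show "integrable M (\<lambda>x. ?w x + \<rho> x powr e2 * indicator B x)"
      using S in_far by (rule Bochner_Integration.integrable_add)
    show "AE x in M. norm ((norm (f2 x))\<^sup>2) \<le> norm (?w x + \<rho> x powr e2 * indicator B x)"
    proof (rule AE_I2)
      fix x assume x: "x \<in> space M"
      have "(norm (f2 x))\<^sup>2 \<le> ?w x + \<rho> x powr e2 * indicator B x"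
      proof (cases "x \<in> E")
        case False
        then show ?thesis using far[of "norm (f x)" "\<rho> x"] x by (auto simp: f2_def E_def B_def not_le not_less)
      qed (simp add: f2_def)
      then show "norm ((norm (f2 x))\<^sup>2) \<le> norm (?w x + \<rho> x powr e2 * indicator B x)"
        by simp
    qed
  qed simp
  ultimately show ?thesis
    by (intro that[of f1 f2]) (auto simp: L1_space_iff L2_space_iff f1_def f2_def)
qed

text \<open>A function of height H on a set of measure V, at gauge about V^(1/D), has source norm
  about V^\<sigma> H. By \<open>power_integral_lower_bound\<close> the norm cannot be smaller than a
  constant times this, wherever the set lies.\<close>

abbreviation \<sigma> :: real where "\<sigma> \<equiv> 1 / p + l / D"

text \<open>Here the balance of exponents enters. V H is the size of the transform up to gauge
  V^(-1/D), and integrating \<rho>^(\<alpha> q) over that ball yields the last factor.\<close>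

lemma scaling_exponent:
  assumes "V > 0" "H > 0"
  shows "(V powr \<sigma> * H) powr q = (V * H) powr q * V powr (- \<alpha> * q / D - 1)"
proof -
  have "\<sigma> * q = q + (- \<alpha> * q / D - 1)"
    unfolding inverse_exponent using q_gt D_pos by (simp add: field_simps)
  then show ?thesis using assms
    by (simp add: powr_mult powr_powr powr_add[symmetric] del: minus_mult_minus)
qed

text \<open>Strict inequalities leave room for the small exponent \<open>\<gamma>\<close>. For \<open>q < 2\<close> the far part uses
  \<open>X\<^sup>q \<le> \<mu>\<^bsup>q-2\<^esup> X\<^sup>2 + \<mu>\<^sup>q\<close> with \<open>\<mu> = L y\<^bsup>-\<kappa>\<^esup>\<close>, which replaces Hoelder's inequality.\<close>

lemma far_pointwise:
  assumes b: "b \<ge> 0"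
  obtains \<gamma> E c where "\<gamma> > 0" "\<gamma> < D + \<alpha> * q" "E > D" "c \<ge> 0"
    "\<And>y L X. y \<ge> 1 \<Longrightarrow> L > 0 \<Longrightarrow> 0 \<le> X \<Longrightarrow> X \<le> b * L \<Longrightarrow>
       y powr (\<gamma> + \<alpha> * q) * X powr q \<le> c * (L powr (q - 2) * X\<^sup>2 + L powr q * y powr - E)"
proof (cases "q \<ge> 2")
  case True
  obtain m where m: "0 < m" "m \<le> D + \<alpha> * q" "m \<le> - (\<alpha> * q)"
    by (rule that[of "min (D + \<alpha> * q) (- (\<alpha> * q))"]) (use neg_alpha_q in auto)
  define \<gamma> where "\<gamma> = m / 2"
  show ?thesis
  \<comment> \<open>The L2 term alone suffices for q \<ge> 2, so any exponent above D serves for the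
    other one.\<close>
  proof (rule that[of \<gamma> "D + 1" "b powr (q - 2)"])
    show "\<gamma> > 0" "\<gamma> < D + \<alpha> * q" using m by (auto simp: \<gamma>_def)
    fix y L X :: real assume *: "y \<ge> 1" "L > 0" "0 \<le> X" "X \<le> b * L"
    have \<gamma>: "\<gamma> + \<alpha> * q \<le> 0" using m unfolding \<gamma>_def by linarith
    have y: "y powr (\<gamma> + \<alpha> * q) \<le> 1" using * powr_mono[OF \<gamma> *(1)] by simp
    have X: "X powr q \<le> b powr (q - 2) * (L powr (q - 2) * X\<^sup>2)"
    proof (cases "X = 0")
      case False
      then have X0: "X > 0" using * by simp
      then have "X powr q = X powr (q - 2) * X powr 2" using powr_add[of X "q - 2" 2] by simp
      also have "\<dots> \<le> (b * L) powr (q - 2) * X powr 2"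
        using * True by (intro mult_right_mono powr_mono2) auto
      finally show ?thesis using X0 * b by (simp add: powr_mult powr_numeral)
    qed simp
    have "y powr (\<gamma> + \<alpha> * q) * X powr q \<le> 1 * X powr q" using y by (intro mult_right_mono) auto
    also have "\<dots> \<le> b powr (q - 2) * (L powr (q - 2) * X\<^sup>2)" using X by simp
    also have "\<dots> \<le> b powr (q - 2) * (L powr (q - 2) * X\<^sup>2 + L powr q * y powr - (D + 1))"
      by (intro mult_left_mono) auto
    finally show "y powr (\<gamma> + \<alpha> * q) * X powr q
        \<le> b powr (q - 2) * (L powr (q - 2) * X\<^sup>2 + L powr q * y powr - (D + 1))" .
  qed (use D_pos in auto)
next
  case False
  \<comment> \<open>The second entry is the room left by \<open>neg_alpha_q_gt\<close>; using only
    half of \<eta> keeps E > D strict.\<close>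
  define \<eta> where "\<eta> = min (D + \<alpha> * q) (- \<alpha> * q - (1 - q / 2) * D)"
  have \<eta>: "\<eta> > 0" "\<eta> \<le> D + \<alpha> * q" "\<eta> \<le> - \<alpha> * q - (1 - q / 2) * D"
    using neg_alpha_q neg_alpha_q_gt False by (auto simp: \<eta>_def)
  define \<gamma> where "\<gamma> = \<eta> / 2"
  \<comment> \<open>Chosen so that the power of y in front of X^2 cancels once \<mu> = L
    y^(-\<kappa>) is inserted: that term is then bounded by the unweighted L2 norm. E is the decay
    left in the term with \<mu>^q.\<close>
  define \<kappa> where "\<kappa> = (- \<alpha> * q - \<gamma>) / (2 - q)"
  define E where "E = - \<alpha> * q - \<gamma> + \<kappa> * q"
  have \<kappa>: "\<kappa> * (2 - q) = - \<alpha> * q - \<gamma>" using False by (simp add: \<kappa>_def)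
  have E: "E > D"
  proof -
    have "E * (2 - q) = (- \<alpha> * q - \<gamma>) * (2 - q) + (\<kappa> * (2 - q)) * q"
      by (simp add: E_def algebra_simps)
    also have "\<dots> = 2 * (- \<alpha> * q - \<gamma>)" unfolding \<kappa> by (simp add: algebra_simps)
    finally have "E * (2 - q) = 2 * (- \<alpha> * q) - \<eta>" by (simp add: \<gamma>_def)
    moreover have "(1 - q / 2) * D * 2 = D * (2 - q)" by (simp add: algebra_simps)
    ultimately have "E * (2 - q) > D * (2 - q)" using \<eta> by linarith
    then show ?thesis using False by simp
  qed
  show ?thesis
  proof (rule that[of \<gamma> E 1])
    show "\<gamma> > 0" "\<gamma> < D + \<alpha> * q" using \<eta> by (auto simp: \<gamma>_def)
    fix y L X :: real assume *: "y \<ge> 1" "L > 0" "0 \<le> X" "X \<le> b * L"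
    define \<mu> where "\<mu> = L * y powr - \<kappa>"
    have \<mu>: "\<mu> > 0" using * by (simp add: \<mu>_def)
    have "X powr q \<le> \<mu> powr (q - 2) * X\<^sup>2 + \<mu> powr q"
    proof (cases "X \<le> \<mu>")
      case True
      then have "X powr q \<le> \<mu> powr q" using * q_gt by (intro powr_mono2) auto
      then show ?thesis by (smt (verit) mult_nonneg_nonneg powr_ge_zero zero_le_power2)
    next
      case gt: False
      then have X0: "X > 0" using \<mu> by simp
      then have "X powr q = X powr (q - 2) * X powr 2" using powr_add[of X "q - 2" 2] by simp
      also have "\<dots> \<le> \<mu> powr (q - 2) * X powr 2"
        using gt \<mu> False by (intro mult_right_mono powr_mono2') auto
      finally show ?thesis using X0 by (simp add: powr_numeral) (smt (verit) powr_ge_zero)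
    qed
    then have "y powr (\<gamma> + \<alpha> * q) * X powr q
        \<le> y powr (\<gamma> + \<alpha> * q) * (\<mu> powr (q - 2) * X\<^sup>2 + \<mu> powr q)"
      by (intro mult_left_mono) auto
    also have "\<dots> = L powr (q - 2) * X\<^sup>2 * (y powr (\<gamma> + \<alpha> * q) * y powr (- \<kappa> * (q - 2)))
        + L powr q * (y powr (\<gamma> + \<alpha> * q) * y powr (- \<kappa> * q))"
      using * by (simp add: \<mu>_def powr_mult powr_powr algebra_simps)
    also have "y powr (\<gamma> + \<alpha> * q) * y powr (- \<kappa> * (q - 2)) = 1"
    proof -
      have "\<gamma> + \<alpha> * q + - \<kappa> * (q - 2) = 0" using \<kappa> by (simp add: algebra_simps)
      then show ?thesis using * by (simp add: powr_add[symmetric])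
    qed
    also have "y powr (\<gamma> + \<alpha> * q) * y powr (- \<kappa> * q) = y powr - E"
      by (simp add: E_def powr_add[symmetric] algebra_simps)
    finally show "y powr (\<gamma> + \<alpha> * q) * X powr q
        \<le> 1 * (L powr (q - 2) * X\<^sup>2 + L powr q * y powr - E)" by simp
  qed (use E in auto)
qed

text \<open>A function of height \<open>H\<close> on a set of measure \<open>V\<close> satisfies the two norm hypotheses below.\<close>

lemma piece_estimate:
  assumes c1: "c\<^sub>1 > 0"
  obtains \<gamma> C where "\<gamma> > 0" "C \<ge> 0"
    "\<And>G V H. G \<in> Lp_space M 1 \<Longrightarrow> G \<in> Lp_space M 2 \<Longrightarrow> V > 0 \<Longrightarrow> H > 0 \<Longrightarrow>
       (\<integral>x. norm (G x) \<partial>M) \<le> c\<^sub>1 * (V * H) \<Longrightarrow> (\<integral>x. (norm (G x))\<^sup>2 \<partial>M) \<le> c\<^sub>1 * (V * H\<^sup>2) \<Longrightarrow>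
       (\<integral>\<^sup>+x. ennreal (min (V powr (1 / D) * \<rho> x) (1 / (V powr (1 / D) * \<rho> x)) powr - \<gamma>
            * (\<rho> x powr (\<alpha> * q) * norm (F G x) powr q)) \<partial>M)
         \<le> ennreal (C * (V powr \<sigma> * H) powr q)"
proof -
  define b where "b = C\<^sub>0 * c\<^sub>1"
  have b: "b \<ge> 0" using C0_nonneg c1 by (simp add: b_def)
  obtain \<gamma> E c where \<gamma>: "\<gamma> > 0" "\<gamma> < D + \<alpha> * q" and E: "E > D" and c: "c \<ge> 0"
    and far: "\<And>y L X. y \<ge> 1 \<Longrightarrow> L > 0 \<Longrightarrow> 0 \<le> X \<Longrightarrow> X \<le> b * L \<Longrightarrow>
       y powr (\<gamma> + \<alpha> * q) * X powr q \<le> c * (L powr (q - 2) * X\<^sup>2 + L powr q * y powr - E)"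
    using far_pointwise[OF b] by blast
  \<comment> \<open>Inside the ball the factor y^(-\<gamma>) makes the weight more singular;
    \<gamma> < D + \<alpha> q keeps it integrable.\<close>
  define e where "e = \<alpha> * q - \<gamma>"
  have e: "e > - D" using \<gamma> by (simp add: e_def)
  obtain Cn where Cn: "Cn > 0" "\<And>R. R > 0 \<Longrightarrow>
      (\<integral>\<^sup>+x. ennreal (\<rho> x powr e) * indicator {x \<in> space M. \<rho> x < R} x \<partial>M) \<le> ennreal (Cn * R powr (e + D))"
    using near_power_integral[OF e] by blast
  obtain Cf where Cf: "Cf \<ge> 0" "\<And>R. R > 0 \<Longrightarrow>
      (\<integral>\<^sup>+x. ennreal (\<rho> x powr - E) * indicator {x \<in> space M. R \<le> \<rho> x} x \<partial>M) \<le> ennreal (Cf * R powr (- E + D))"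
    using far_power_integral[of "- E"] E by auto
  define C where "C = b powr q * Cn + c * (c\<^sub>1 + Cf)"
  show ?thesis
  proof (rule that[OF \<gamma>(1), of C])
    show "C \<ge> 0" using c Cn Cf c1 b by (simp add: C_def)
    fix G and V H :: real
    assume G: "G \<in> Lp_space M 1" "G \<in> Lp_space M 2" and V: "V > 0" and H: "H > 0"
      and G1: "(\<integral>x. norm (G x) \<partial>M) \<le> c\<^sub>1 * (V * H)" and G2: "(\<integral>x. (norm (G x))\<^sup>2 \<partial>M) \<le> c\<^sub>1 * (V * H\<^sup>2)"
    have [measurable]: "F G \<in> borel_measurable M" using F_measurable[OF G(2)] .
    \<comment> \<open>1 / t is the gauge around which the transform concentrates: below it only the
      sup bound b L is used, above it also the L2 norm.\<close>
    define t where "t = V powr (1 / D)"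
    have t: "t > 0" using V by (simp add: t_def)
    have tD: "t powr x = V powr (x / D)" for x by (simp add: t_def powr_powr)
    define L where "L = V * H"
    have L: "L > 0" using V H by (simp add: L_def)
    let ?X = "\<lambda>x. norm (F G x)"
    let ?n = "indicator {x \<in> space M. \<rho> x < 1 / t}" and ?f = "indicator {x \<in> space M. 1 / t \<le> \<rho> x}"
    \<comment> \<open>Coefficients of the sup part inside the ball, of the L2 part outside, and of
      the tail outside.\<close>
    let ?a = "(b * L) powr q * t powr - \<gamma>" and ?b = "t powr (- \<alpha> * q) * c * L powr (q - 2)"
    let ?c = "t powr (- \<alpha> * q) * c * L powr q * t powr - E"
    have X: "AE x in M. ?X x \<le> b * L"
      using F_bound[OF G]
    proof eventually_elim
      case (elim x)
      also have "C\<^sub>0 * (\<integral>x. norm (G x) \<partial>M) \<le> C\<^sub>0 * (c\<^sub>1 * (V * H))"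
        using G1 C0_nonneg by (intro mult_left_mono)
      finally show ?case by (simp add: b_def L_def mult_ac)
    qed
    have iX: "(\<integral>\<^sup>+x. ennreal ((?X x)\<^sup>2) \<partial>M) \<le> ennreal (c\<^sub>1 * (V * H\<^sup>2))"
    proof -
      have "(\<integral>\<^sup>+x. ennreal ((?X x)\<^sup>2) \<partial>M) = ennreal (\<integral>x. (?X x)\<^sup>2 \<partial>M)"
        using F_L2[OF G(2)] by (intro nn_integral_eq_integral) (auto simp: L2_space_iff)
      then show ?thesis using G2 F_isometry[OF G(2)] by (simp add: ennreal_leI)
    qed
    have "(\<integral>\<^sup>+x. ennreal (min (t * \<rho> x) (1 / (t * \<rho> x)) powr - \<gamma> * (\<rho> x powr (\<alpha> * q) * ?X x powr q)) \<partial>M)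
        \<le> (\<integral>\<^sup>+x. (ennreal ?a * (ennreal (\<rho> x powr e) * ?n x) + ennreal ?b * ennreal ((?X x)\<^sup>2))
            + ennreal ?c * (ennreal (\<rho> x powr - E) * ?f x) \<partial>M)"
    proof (rule nn_integral_mono_AE, use rho_pos X AE_space[of M] in eventually_elim)
      case (elim x)
      note r = elim(1) and Xb = elim(2) and x = elim(3)
      define y where "y = t * \<rho> x"
      have y: "y > 0" using t r by (simp add: y_def)
      show ?case
      proof (cases "y < 1")
        case True
        then have n: "?n x = (1::ennreal)" using x t by (simp add: y_def field_simps)
        have "1 \<le> 1 / y" using True y by simp
        then have "min y (1 / y) = y" using True by (intro min_absorb1) linarith
        then have "min y (1 / y) powr - \<gamma> * (\<rho> x powr (\<alpha> * q) * ?X x powr q)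
            = t powr - \<gamma> * \<rho> x powr e * ?X x powr q"
          using t r by (simp add: y_def e_def powr_mult powr_diff powr_minus divide_inverse)
        also have "\<dots> \<le> t powr - \<gamma> * \<rho> x powr e * (b * L) powr q"
          using Xb q_gt by (intro mult_left_mono powr_mono2) auto
        finally have "ennreal (min y (1 / y) powr - \<gamma> * (\<rho> x powr (\<alpha> * q) * ?X x powr q))
            \<le> ennreal ?a * (ennreal (\<rho> x powr e) * ?n x)"
          unfolding n by (simp add: ennreal_mult[symmetric] mult_ac ennreal_leI)
        then show ?thesis unfolding y_def[symmetric] by (simp add: add_increasing2 add.assoc)
      next
        case False
        then have f: "?f x = (1::ennreal)" using x t by (simp add: y_def field_simps)
        have "1 / y \<le> 1" using False y by simp
        then have "min y (1 / y) = 1 / y" using False by (intro min_absorb2) linarith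
        then have "min y (1 / y) powr - \<gamma> * (\<rho> x powr (\<alpha> * q) * ?X x powr q)
            = t powr (- \<alpha> * q) * (y powr (\<gamma> + \<alpha> * q) * ?X x powr q)"
        proof -
          assume m: "min y (1 / y) = 1 / y"
          have "(1 / y) powr - \<gamma> = y powr \<gamma>" using y by (simp add: powr_divide powr_minus)
          moreover have "\<rho> x powr (\<alpha> * q) = t powr (- \<alpha> * q) * y powr (\<alpha> * q)"
            using t r by (simp add: y_def powr_mult powr_minus)
          ultimately show ?thesis unfolding m by (simp add: powr_add)
        qed
        also have "\<dots> \<le> t powr (- \<alpha> * q) * (c * (L powr (q - 2) * (?X x)\<^sup>2 + L powr q * y powr - E))"
          using False L Xb by (intro mult_left_mono far) auto
        also have "\<dots> = ?b * (?X x)\<^sup>2 + ?c * \<rho> x powr - E"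
          using t r by (simp add: y_def powr_mult algebra_simps)
        finally have "ennreal (min y (1 / y) powr - \<gamma> * (\<rho> x powr (\<alpha> * q) * ?X x powr q))
            \<le> ennreal (?b * (?X x)\<^sup>2 + ?c * \<rho> x powr - E)" by (rule ennreal_leI)
        also have "\<dots> = ennreal ?b * ennreal ((?X x)\<^sup>2) + ennreal ?c * (ennreal (\<rho> x powr - E) * ?f x)"
          unfolding f using c by (simp add: ennreal_plus ennreal_mult)
        finally show ?thesis unfolding y_def[symmetric] by (simp add: add_increasing add.assoc)
      qed
    qed
    also have "\<dots> = (ennreal ?a * (\<integral>\<^sup>+x. ennreal (\<rho> x powr e) * ?n x \<partial>M) + ennreal ?b * (\<integral>\<^sup>+x. ennreal ((?X x)\<^sup>2) \<partial>M))
        + ennreal ?c * (\<integral>\<^sup>+x. ennreal (\<rho> x powr - E) * ?f x \<partial>M)"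
      by (simp add: nn_integral_add nn_integral_cmult)
    also have "\<dots> \<le> (ennreal ?a * ennreal (Cn * (1 / t) powr (e + D)) + ennreal ?b * ennreal (c\<^sub>1 * (V * H\<^sup>2)))
        + ennreal ?c * ennreal (Cf * (1 / t) powr (- E + D))"
      using t by (intro add_mono mult_left_mono Cn Cf iX) auto
    also have "\<dots> = ennreal (?a * (Cn * (1 / t) powr (e + D)) + ?b * (c\<^sub>1 * (V * H\<^sup>2))
        + ?c * (Cf * (1 / t) powr (- E + D)))"
      using c Cn Cf c1 V H by (simp add: ennreal_plus ennreal_mult)
    also have "?a * (Cn * (1 / t) powr (e + D)) + ?b * (c\<^sub>1 * (V * H\<^sup>2)) + ?c * (Cf * (1 / t) powr (- E + D))
        = C * (V powr \<sigma> * H) powr q"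
    proof -
      have it: "(1 / t) powr x = t powr - x" for x using t by (simp add: powr_divide powr_minus_divide)
      \<comment> \<open>The common scale: once powers of t are written as powers of V, each of the
        three parts is a constant times \<open>L powr q * ?W\<close>.\<close>
      let ?W = "V powr (- \<alpha> * q / D - 1)"
      have a: "t powr - \<gamma> * (1 / t) powr (e + D) = ?W"
      proof -
        have "- \<gamma> + - (e + D) = - \<alpha> * q - D" by (simp add: e_def)
        then have "t powr - \<gamma> * t powr - (e + D) = t powr (- \<alpha> * q - D)"
          unfolding powr_add[symmetric] by (rule arg_cong)
        also have "\<dots> = ?W" unfolding tD using D_pos by (simp add: diff_divide_distrib)
        finally show ?thesis unfolding it .
      qed
      have "?a * (Cn * (1 / t) powr (e + D)) = (b * L) powr q * Cn * (t powr - \<gamma> * (1 / t) powr (e + D))"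
        by simp
      also have "\<dots> = b powr q * Cn * (L powr q * ?W)"
        unfolding a using b L by (simp add: powr_mult)
      finally have 1: "?a * (Cn * (1 / t) powr (e + D)) = b powr q * Cn * (L powr q * ?W)" .
      have tW: "t powr (- \<alpha> * q) = V * ?W"
        unfolding tD using V by (simp add: powr_diff)
      have LL: "L powr (q - 2) * (V * (V * H\<^sup>2)) = L powr q"
        using L powr_add[of L "q - 2" 2] by (simp add: powr_numeral) (simp add: L_def power2_eq_square mult_ac)
      have "?b * (c\<^sub>1 * (V * H\<^sup>2)) = c * c\<^sub>1 * (L powr (q - 2) * (V * (V * H\<^sup>2))) * ?W"
        unfolding tW by simp
      then have 2: "?b * (c\<^sub>1 * (V * H\<^sup>2)) = c * c\<^sub>1 * (L powr q * ?W)" unfolding LL by simp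
      have "t powr - E * (1 / t) powr (- E + D) = t powr - D"
        unfolding it powr_add[symmetric] by simp
      also have "\<dots> = 1 / V" unfolding tD using V D_pos by (simp add: powr_minus divide_inverse)
      finally have tE: "t powr - E * (1 / t) powr (- E + D) = 1 / V" .
      have "?c * (Cf * (1 / t) powr (- E + D))
          = t powr (- \<alpha> * q) * c * L powr q * Cf * (t powr - E * (1 / t) powr (- E + D))" by simp
      also have "\<dots> = c * Cf * (L powr q * ?W)" unfolding tE tW using V by simp
      finally have 3: "?c * (Cf * (1 / t) powr (- E + D)) = c * Cf * (L powr q * ?W)" .
      have S: "(V powr \<sigma> * H) powr q = L powr q * ?W"
        using scaling_exponent[OF V H] by (simp add: L_def)
      show ?thesis unfolding 1 2 3 S C_def by (simp add: distrib_left distrib_right)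
    qed
    finally show "(\<integral>\<^sup>+x. ennreal (min (V powr (1 / D) * \<rho> x) (1 / (V powr (1 / D) * \<rho> x)) powr - \<gamma>
            * (\<rho> x powr (\<alpha> * q) * norm (F G x) powr q)) \<partial>M)
         \<le> ennreal (C * (V powr \<sigma> * H) powr q)"
      by (simp add: t_def)
  qed
qed

end

section \<open>Summation over the pieces\<close>

lemma dyadic_tent_eq:
  fixes D r :: real and j :: int
  assumes "D > 0" "r > 0"
  defines "u \<equiv> (2 powr of_int j) powr (1 / D) * r"
  shows "min u (1 / u) = 2 powr (- \<bar>of_int j + D * log 2 r\<bar> / D)"
proof -
  \<comment> \<open>On a logarithmic scale the factor is a tent in j with peak at -D log 2 r, the
    form that \<open>sum_tent_le\<close> sums.\<close>
  have r: "r = 2 powr log 2 r" using assms by simp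
  have u: "u = 2 powr ((of_int j + D * log 2 r) / D)"
    unfolding u_def by (subst r) (use \<open>D > 0\<close> in \<open>simp add: powr_powr powr_add[symmetric] add_divide_distrib del: powr_log_cancel\<close>)
  then have iu: "1 / u = 2 powr (- ((of_int j + D * log 2 r) / D))" by (simp add: powr_minus_divide)
  show ?thesis
  proof (cases "of_int j + D * log 2 r \<ge> 0")
    case True
    then have "(of_int j + D * log 2 r) / D \<ge> 0" using \<open>D > 0\<close> by simp
    then have "1 / u \<le> u" unfolding iu unfolding u by (intro powr_mono) auto
    then have "min u (1 / u) = 1 / u" by (rule min_absorb2)
    then show ?thesis unfolding iu abs_of_nonneg[OF True] minus_divide_left .
  next
    case False
    then have "(of_int j + D * log 2 r) / D \<le> 0" using \<open>D > 0\<close> by (simp add: divide_le_0_iff)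
    then have "u \<le> 1 / u" unfolding iu unfolding u by (intro powr_mono) auto
    then have "min u (1 / u) = u" by (rule min_absorb1)
    then show ?thesis unfolding u using False by (simp only: not_le abs_of_neg minus_minus)
  qed
qed

context pitt_setting
begin

text \<open>The constant must not depend on B. The bounds on h confine the levels to the finite set
  \<open>N0\<close>, so that \<open>F_sum\<close> can split the transform.\<close>

lemma bounded_below_case:
  obtains C where "C \<ge> 0"
    "\<And>h B S. h \<in> Lp_space M 2 \<Longrightarrow> B > 0 \<Longrightarrow>
       (\<And>x. x \<in> space M \<Longrightarrow> h x = 0 \<or> 1 / B \<le> norm (h x) \<and> norm (h x) \<le> B) \<Longrightarrow> S \<ge> 0 \<Longrightarrow>
       (\<integral>\<^sup>+x. ennreal (norm (h x) powr p * \<rho> x powr (l * p)) \<partial>M) \<le> ennreal S \<Longrightarrow>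
       (\<integral>\<^sup>+x. ennreal (norm (F h x) powr q * \<rho> x powr (\<alpha> * q)) \<partial>M) \<le> ennreal (C * S powr (q / p))"
proof -
  \<comment> \<open>The 16 comes from the squared L2 norm: 4 because values may reach 2^(n+1), 2
    because measures may reach 2 V, and 2 from the geometric sum. The L1 norm gives only 8.\<close>
  obtain \<gamma> Cp where \<gamma>: "\<gamma> > 0" and Cp: "Cp \<ge> 0"
    and piece: "\<And>G V H. G \<in> Lp_space M 1 \<Longrightarrow> G \<in> Lp_space M 2 \<Longrightarrow> V > 0 \<Longrightarrow> H > 0 \<Longrightarrow>
       (\<integral>x. norm (G x) \<partial>M) \<le> 16 * (V * H) \<Longrightarrow> (\<integral>x. (norm (G x))\<^sup>2 \<partial>M) \<le> 16 * (V * H\<^sup>2) \<Longrightarrow>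
       (\<integral>\<^sup>+x. ennreal (min (V powr (1 / D) * \<rho> x) (1 / (V powr (1 / D) * \<rho> x)) powr - \<gamma>
            * (\<rho> x powr (\<alpha> * q) * norm (F G x) powr q)) \<partial>M)
         \<le> ennreal (Cp * (V powr \<sigma> * H) powr q)"
    using piece_estimate[of 16] by auto
  have lp: "l * p \<ge> 0" using l_pos p_gt by simp
  obtain c where c: "c > 0"
    and lower: "\<And>A m. A \<in> sets M \<Longrightarrow> m \<ge> 0 \<Longrightarrow> emeasure M A = ennreal m \<Longrightarrow>
       ennreal (c * m powr (1 + l * p / D)) \<le> (\<integral>\<^sup>+x. ennreal (\<rho> x powr (l * p)) * indicator A x \<partial>M)"
    using power_integral_lower_bound[OF lp] by blast
  \<comment> \<open>In \<open>sum_powr_le_weighted\<close> the weights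
    \<open>?\<phi> j x powr \<delta>\<close> reappear to the power 1 - q, which this choice turns
    into the exponent -\<gamma> of the piece estimate.\<close>
  define \<delta> where "\<delta> = \<gamma> / (q - 1)"
  have \<delta>: "\<delta> > 0" using \<gamma> q_gt by (simp add: \<delta>_def)
  define CJ where "CJ = 2 / (1 - 2 powr - (\<delta> / D))"
  show ?thesis
  proof (rule that[of "CJ powr (q - 1) * Cp * (1 / c) powr (q / p)"])
    show "CJ powr (q - 1) * Cp * (1 / c) powr (q / p) \<ge> 0" using Cp by simp
    fix h :: "'x \<Rightarrow> complex" and B S :: real
    assume h2: "h \<in> Lp_space M 2" and B: "B > 0" and S: "S \<ge> 0"
      and hB: "\<And>x. x \<in> space M \<Longrightarrow> h x = 0 \<or> 1 / B \<le> norm (h x) \<and> norm (h x) \<le> B"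
      and hS: "(\<integral>\<^sup>+x. ennreal (norm (h x) powr p * \<rho> x powr (l * p)) \<partial>M) \<le> ennreal S"
    have [measurable]: "h \<in> borel_measurable M" using h2 by (simp add: L2_space_iff)
    define \<nu> where "\<nu> x = \<lfloor>log 2 (norm (h x))\<rfloor>" for x
    define A where "A n = {x \<in> space M. h x \<noteq> 0 \<and> \<nu> x = n}" for n
    have A [measurable]: "A n \<in> sets M" for n unfolding A_def \<nu>_def by measurable
    define N0 where "N0 = {\<lfloor>log 2 (1 / B)\<rfloor>..\<lfloor>log 2 B\<rfloor>}"
    have N0: "\<nu> x \<in> N0" if "x \<in> space M" "h x \<noteq> 0" for x
      using hB[OF that(1)] that(2) B unfolding \<nu>_def N0_def
      by (auto intro!: floor_mono simp: log_le_cancel_iff)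
    have A_bounds: "2 powr of_int n \<le> norm (h x)" "norm (h x) \<le> 2 powr (of_int n + 1)" if "x \<in> A n" for x n
    proof -
      have hx: "norm (h x) > 0" "\<nu> x = n" using that by (auto simp: A_def)
      then have "of_int n \<le> log 2 (norm (h x))" "log 2 (norm (h x)) \<le> of_int n + 1"
        by (auto simp: \<nu>_def)
      then show "2 powr of_int n \<le> norm (h x)" "norm (h x) \<le> 2 powr (of_int n + 1)"
        using hx by (simp_all add: le_log_iff log_le_iff)
    qed
    have A_fin: "emeasure M (A n) < \<infinity>" for n
    proof -
      have "ennreal ((2 powr of_int n)\<^sup>2) * emeasure M (A n) = (\<integral>\<^sup>+x. ennreal ((2 powr of_int n)\<^sup>2) * indicator (A n) x \<partial>M)"
        by (simp add: nn_integral_cmult_indicator)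
      also have "\<dots> \<le> (\<integral>\<^sup>+x. ennreal ((norm (h x))\<^sup>2) \<partial>M)"
        using A_bounds(1)[of _ n] by (intro nn_integral_mono) (auto simp: indicator_def intro!: ennreal_leI power_mono)
      also have "\<dots> < \<infinity>"
      proof -
        have "integrable M (\<lambda>x. (norm (h x))\<^sup>2)" using h2 by (simp add: L2_space_iff)
        then show ?thesis by (simp add: nn_integral_eq_integral)
      qed
      finally show ?thesis by (auto simp: ennreal_mult_less_top)
    qed
    define m where "m n = measure M (A n)" for n
    have m: "emeasure M (A n) = ennreal (m n)" "m n \<ge> 0" for n
      using A_fin[of n] by (auto simp: m_def emeasure_eq_ennreal_measure)
    \<comment> \<open>Levels of measure 0 have no meaningful logarithm \<open>\<iota>\<close>. Their
      union is a null set, which is why \<open>h_sum\<close> holds only almost everywhere.\<close>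
    define I where "I = {n \<in> N0. m n > 0}"
    have I: "finite I" unfolding I_def N0_def by (rule finite_subset[of _ "{\<lfloor>log 2 (1 / B)\<rfloor>..\<lfloor>log 2 B\<rfloor>}"]) auto
    define \<iota> where "\<iota> n = \<lfloor>log 2 (m n)\<rfloor>" for n
    define G where "G j = {n \<in> I. \<iota> n = j}" for j
    define J where "J = \<iota> ` I"
    have J: "finite J" using I by (simp add: J_def)
    have G: "finite (G j)" for j using I by (simp add: G_def)
    have G_ne: "G j \<noteq> {}" if "j \<in> J" for j using that by (auto simp: J_def G_def)
    define V where "V j = (2::real) powr of_int j" for j :: int
    \<comment> \<open>The highest level stands for the whole piece: it dominates both norms from
      above, and it alone is kept in the lower bound for the source integral.\<close>
    define H where "H j = (2::real) powr of_int (Max (G j))" for j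
    have V: "V j > 0" and H: "H j > 0" for j by (simp_all add: V_def H_def)
    have mV: "V j \<le> m n" "m n \<le> 2 * V j" if "n \<in> G j" for n j
    proof -
      have mn: "m n > 0" "\<iota> n = j" using that by (auto simp: G_def I_def)
      then have "of_int j \<le> log 2 (m n)" "log 2 (m n) \<le> of_int j + 1"
        by (auto simp: \<iota>_def)
      then show "V j \<le> m n" "m n \<le> 2 * V j"
        using mn by (simp_all add: V_def le_log_iff log_le_iff powr_add)
    qed
    define E where "E j = (\<Union>n\<in>G j. A n)" for j
    have [measurable]: "E j \<in> sets M" for j unfolding E_def using G by auto
    define g where "g j x = indicator (E j) x * h x" for j x
    have g2: "g j \<in> Lp_space M 2" for j
      using L2_space_cut[OF h2, of "E j"] by (simp add: g_def[abs_def])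
    have [measurable]: "g j \<in> borel_measurable M" for j using g2 by (simp add: L2_space_iff)
    have iA: "integrable M (\<lambda>x. \<Sum>n\<in>G j. a n * indicator (A n) x)" for j and a :: "int \<Rightarrow> real"
      using A_fin by (intro Bochner_Integration.integrable_sum integrable_mult_right integrable_real_indicator A) auto
    have IA: "(\<integral>x. (\<Sum>n\<in>G j. a n * indicator (A n) x) \<partial>M) = (\<Sum>n\<in>G j. a n * m n)" for j and a :: "int \<Rightarrow> real"
      using A_fin by (subst Bochner_Integration.integral_sum) (auto simp: m_def intro!: integrable_real_indicator)
    have g_le: "norm (g j x) ^ k \<le> (\<Sum>n\<in>G j. (2 powr (of_int n + 1)) ^ k * indicator (A n) x)"
      if "k > 0" for j x k
    proof (cases "x \<in> E j")
      case True
      then obtain n where n: "n \<in> G j" "x \<in> A n" by (auto simp: E_def)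
      have "norm (g j x) ^ k \<le> (2 powr (of_int n + 1)) ^ k * indicator (A n) x"
        using A_bounds(2)[OF n(2)] True n(2) by (auto simp: g_def intro!: power_mono)
      also have "\<dots> \<le> (\<Sum>n\<in>G j. (2 powr (of_int n + 1)) ^ k * indicator (A n) x)"
        using G n by (intro member_le_sum[of n "G j" "\<lambda>n. (2 powr (of_int n + 1)) ^ k * indicator (A n) x"]) auto
      finally show ?thesis .
    next
      case False
      then show ?thesis using that by (simp add: g_def zero_power sum_nonneg)
    qed
    have g1: "g j \<in> Lp_space M 1" for j
    proof -
      have "integrable M (g j)"
        by (rule Bochner_Integration.integrable_bound[OF iA[of "\<lambda>n. 2 powr (of_int n + 1)" j]])
          (use g_le[of 1 j] in \<open>auto intro: order_trans[OF _ abs_ge_self]\<close>)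
      then show ?thesis by (simp add: L1_space_iff)
    qed
    have G1: "(\<integral>x. norm (g j x) \<partial>M) \<le> 16 * (V j * H j)" if "j \<in> J" for j
    proof -
      have "(\<integral>x. norm (g j x) \<partial>M) \<le> (\<integral>x. (\<Sum>n\<in>G j. 2 powr (of_int n + 1) * indicator (A n) x) \<partial>M)"
        using g1[of j] g_le[of 1 j] by (intro integral_mono iA) (auto simp: L1_space_iff)
      also have "\<dots> = (\<Sum>n\<in>G j. 2 powr (of_int n + 1) * m n)" by (rule IA)
      also have "\<dots> \<le> (\<Sum>n\<in>G j. 2 powr (of_int n + 1) * (2 * V j))"
        by (intro sum_mono mult_left_mono mV) auto
      also have "\<dots> = 4 * V j * (\<Sum>n\<in>G j. 2 powr of_int n)"
        by (simp add: powr_add sum_distrib_left mult_ac)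
      also have "\<dots> \<le> 4 * V j * (2 * H j)"
        unfolding H_def using V[of j] G_ne[OF that] G by (intro mult_left_mono sum_powr_le_Max) auto
      finally have "(\<integral>x. norm (g j x) \<partial>M) \<le> 8 * (V j * H j)" by simp
      then show ?thesis using mult_pos_pos[OF V[of j] H[of j]] by linarith
    qed
    have G2: "(\<integral>x. (norm (g j x))\<^sup>2 \<partial>M) \<le> 16 * (V j * (H j)\<^sup>2)" if "j \<in> J" for j
    proof -
      have four: "(2 powr x)\<^sup>2 = 4 powr x" for x :: real
        using powr_mult[of 2 2 x] by (simp add: power2_eq_square)
      have "(\<integral>x. (norm (g j x))\<^sup>2 \<partial>M) \<le> (\<integral>x. (\<Sum>n\<in>G j. (2 powr (of_int n + 1))\<^sup>2 * indicator (A n) x) \<partial>M)"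
        using g2[of j] g_le[of 2 j] by (intro integral_mono iA) (auto simp: L2_space_iff)
      also have "\<dots> = (\<Sum>n\<in>G j. (2 powr (of_int n + 1))\<^sup>2 * m n)" by (rule IA)
      also have "\<dots> \<le> (\<Sum>n\<in>G j. (2 powr (of_int n + 1))\<^sup>2 * (2 * V j))"
        by (intro sum_mono mult_left_mono mV) auto
      also have "\<dots> = 8 * V j * (\<Sum>n\<in>G j. 4 powr of_int n)"
        unfolding four by (simp add: powr_add sum_distrib_left mult_ac)
      also have "\<dots> \<le> 8 * V j * (2 * 4 powr of_int (Max (G j)))"
        using V[of j] G_ne[OF that] G by (intro mult_left_mono sum_powr_le_Max) auto
      finally show ?thesis by (simp add: H_def four)
    qed
    have h_sum: "AE x in M. (\<Sum>j\<in>J. g j x) = h x"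
    proof -
      have "(\<Union>n\<in>N0 - I. A n) \<in> null_sets M"
      proof (rule null_sets_UN')
        fix n assume "n \<in> N0 - I"
        then have "m n = 0" using m(2)[of n] by (simp add: I_def)
        then show "A n \<in> null_sets M" using m(1)[of n] A[of n] by (simp add: null_sets_def)
      qed (simp add: N0_def countable_finite)
      then have "AE x in M. x \<notin> (\<Union>n\<in>N0 - I. A n)" by (rule AE_not_in)
      then show ?thesis using AE_space[of M]
      proof eventually_elim
        case (elim x)
        show ?case
        proof (cases "h x = 0")
          case False
          have xA: "x \<in> A (\<nu> x)" using False elim by (simp add: A_def)
          then have I\<nu>: "\<nu> x \<in> I" using elim N0[OF elim(2) False] by blast
          have "x \<in> E j \<longleftrightarrow> j = \<iota> (\<nu> x)" for j
            using xA I\<nu> by (auto simp: E_def G_def A_def)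
          then have "(\<Sum>j\<in>J. g j x) = (\<Sum>j\<in>J. if j = \<iota> (\<nu> x) then h x else 0)"
            by (intro sum.cong) (auto simp: g_def)
          then show ?thesis using J I\<nu> by (simp add: J_def)
        qed (simp add: g_def)
      qed
    qed
    have F_h: "AE x in M. F h x = (\<Sum>j\<in>J. F (g j) x)"
    proof -
      have "AE x in M. F (\<lambda>x. \<Sum>j\<in>J. g j x) x = (\<Sum>j\<in>J. F (g j) x)" by (rule F_sum[OF J g2])
      then show ?thesis
        using F_cong_AE[OF L2_space_sum[OF J g2] h2 h_sum] by eventually_elim simp
    qed
    have F_meas [measurable]: "F (g j) \<in> borel_measurable M" for j using F_measurable[OF g2] .
    let ?u = "\<lambda>j x. V j powr (1 / D) * \<rho> x"
    let ?\<phi> = "\<lambda>j x. min (?u j x) (1 / ?u j x)"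
    have "(\<integral>\<^sup>+x. ennreal (norm (F h x) powr q * \<rho> x powr (\<alpha> * q)) \<partial>M)
       \<le> (\<integral>\<^sup>+x. ennreal (CJ powr (q - 1)) *
          (\<Sum>j\<in>J. ennreal (?\<phi> j x powr - \<gamma> * (\<rho> x powr (\<alpha> * q) * norm (F (g j) x) powr q))) \<partial>M)"
    proof (rule nn_integral_mono_AE, use F_h rho_pos in eventually_elim)
      case (elim x)
      have \<phi>: "?\<phi> j x > 0" for j using elim V[of j] by simp
      have sum_\<phi>: "(\<Sum>j\<in>J. ?\<phi> j x powr \<delta>) \<le> CJ"
      proof -
        have "(\<Sum>j\<in>J. ?\<phi> j x powr \<delta>)
            = (\<Sum>j\<in>J. 2 powr (- (\<delta> / D) * \<bar>of_int j + D * log 2 (\<rho> x)\<bar>))"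
          unfolding V_def dyadic_tent_eq[OF D_pos elim(2)] unfolding powr_powr by (simp add: mult.commute)
        also have "\<dots> \<le> CJ" unfolding CJ_def using J \<delta> D_pos by (intro sum_tent_le) auto
        finally show ?thesis .
      qed
      have "norm (F h x) powr q \<le> (\<Sum>j\<in>J. norm (F (g j) x)) powr q"
        using elim q_gt by (intro powr_mono2) (auto intro: norm_sum)
      also have "\<dots> \<le> (\<Sum>j\<in>J. ?\<phi> j x powr \<delta>) powr (q - 1)
          * (\<Sum>j\<in>J. (?\<phi> j x powr \<delta>) powr (1 - q) * norm (F (g j) x) powr q)"
        using J \<phi> q_gt by (intro sum_powr_le_weighted) (auto simp: less_imp_neq[symmetric])
      also have "\<dots> \<le> CJ powr (q - 1) * (\<Sum>j\<in>J. (?\<phi> j x powr \<delta>) powr (1 - q) * norm (F (g j) x) powr q)"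
        using sum_\<phi> q_gt by (intro mult_right_mono powr_mono2 sum_nonneg) auto
      also have "(\<lambda>j. (?\<phi> j x powr \<delta>) powr (1 - q)) = (\<lambda>j. ?\<phi> j x powr - \<gamma>)"
      proof -
        have "\<delta> * (1 - q) = - \<gamma>" using q_gt by (simp add: \<delta>_def field_simps)
        then show ?thesis by (simp add: powr_powr)
      qed
      finally have "norm (F h x) powr q * \<rho> x powr (\<alpha> * q)
          \<le> CJ powr (q - 1) * (\<Sum>j\<in>J. ?\<phi> j x powr - \<gamma> * norm (F (g j) x) powr q) * \<rho> x powr (\<alpha> * q)"
        by (intro mult_right_mono) (auto simp: fun_eq_iff)
      also have "\<dots> = CJ powr (q - 1) *
          (\<Sum>j\<in>J. ?\<phi> j x powr - \<gamma> * (\<rho> x powr (\<alpha> * q) * norm (F (g j) x) powr q))"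
        by (simp add: sum_distrib_right sum_distrib_left mult_ac)
      finally have "ennreal (norm (F h x) powr q * \<rho> x powr (\<alpha> * q)) \<le> ennreal (CJ powr (q - 1) *
          (\<Sum>j\<in>J. ?\<phi> j x powr - \<gamma> * (\<rho> x powr (\<alpha> * q) * norm (F (g j) x) powr q)))"
        by (rule ennreal_leI)
      also have "\<dots> = ennreal (CJ powr (q - 1)) *
          (\<Sum>j\<in>J. ennreal (?\<phi> j x powr - \<gamma> * (\<rho> x powr (\<alpha> * q) * norm (F (g j) x) powr q)))"
        by (subst sum_ennreal) (auto intro!: ennreal_mult sum_nonneg)
      finally show ?case .
    qed
    also have "\<dots> = ennreal (CJ powr (q - 1)) * (\<integral>\<^sup>+x.
          (\<Sum>j\<in>J. ennreal (?\<phi> j x powr - \<gamma> * (\<rho> x powr (\<alpha> * q) * norm (F (g j) x) powr q))) \<partial>M)"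
      by (rule nn_integral_cmult) measurable
    also have "(\<integral>\<^sup>+x. (\<Sum>j\<in>J.
          ennreal (?\<phi> j x powr - \<gamma> * (\<rho> x powr (\<alpha> * q) * norm (F (g j) x) powr q))) \<partial>M) = (\<Sum>j\<in>J.
        \<integral>\<^sup>+x. ennreal (?\<phi> j x powr - \<gamma> * (\<rho> x powr (\<alpha> * q) * norm (F (g j) x) powr q)) \<partial>M)"
      by (rule nn_integral_sum) measurable
    also have "ennreal (CJ powr (q - 1)) * (\<Sum>j\<in>J.
        \<integral>\<^sup>+x. ennreal (?\<phi> j x powr - \<gamma> * (\<rho> x powr (\<alpha> * q) * norm (F (g j) x) powr q)) \<partial>M)
      \<le> ennreal (CJ powr (q - 1)) * (\<Sum>j\<in>J. ennreal (Cp * (V j powr \<sigma> * H j) powr q))"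
      by (intro mult_left_mono sum_mono piece g1 g2 V H G1 G2) auto
    also have "\<dots> = ennreal (CJ powr (q - 1) * Cp * (\<Sum>j\<in>J. (V j powr \<sigma> * H j) powr q))"
      using Cp by (simp add: sum_ennreal ennreal_mult'[symmetric] sum_distrib_left[symmetric] mult.assoc)
    also have "\<dots> \<le> ennreal (CJ powr (q - 1) * Cp * ((1 / c) powr (q / p) * S powr (q / p)))"
    proof (intro ennreal_leI mult_left_mono)
      let ?B = "\<lambda>j. (V j powr \<sigma> * H j) powr p"
      let ?w = "\<lambda>x. norm (h x) powr p * \<rho> x powr (l * p)"
      \<comment> \<open>On the top level |h| is at least \<open>H j\<close> and the measure at least
        \<open>V j\<close>; \<open>power_integral_lower_bound\<close> turns that measure into
        weighted mass.\<close>
      have term_le: "ennreal (c * ?B j) \<le> (\<integral>\<^sup>+x. ennreal (?w x) * indicator (A (Max (G j))) x \<partial>M)"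
        if j: "j \<in> J" for j
      proof -
        define n where "n = Max (G j)"
        have n: "n \<in> G j" unfolding n_def using G G_ne[OF j] by (rule Max_in)
        have "\<sigma> * p = 1 + l * p / D" using p_gt by (simp add: field_simps)
        then have "?B j = V j powr (1 + l * p / D) * H j powr p"
          using V[of j] H[of j] by (simp add: powr_mult powr_powr)
        also have "\<dots> \<le> m n powr (1 + l * p / D) * H j powr p"
          using mV(1)[OF n] V[of j] lp D_pos by (intro mult_right_mono powr_mono2) auto
        finally have "ennreal (c * ?B j) \<le> ennreal (H j powr p) * ennreal (c * m n powr (1 + l * p / D))"
          using c by (simp add: ennreal_mult[symmetric] mult_ac ennreal_leI)
        also have "\<dots> \<le> ennreal (H j powr p) * (\<integral>\<^sup>+x. ennreal (\<rho> x powr (l * p)) * indicator (A n) x \<partial>M)"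
          by (intro mult_left_mono lower A m) auto
        also have "\<dots> = (\<integral>\<^sup>+x. ennreal (H j powr p) * (ennreal (\<rho> x powr (l * p)) * indicator (A n) x) \<partial>M)"
          by (simp add: nn_integral_cmult)
        also have "\<dots> \<le> (\<integral>\<^sup>+x. ennreal (?w x) * indicator (A n) x \<partial>M)"
        proof (rule nn_integral_mono)
          fix x
          show "ennreal (H j powr p) * (ennreal (\<rho> x powr (l * p)) * indicator (A n) x)
              \<le> ennreal (?w x) * indicator (A n) x"
          proof (cases "x \<in> A n")
            case True
            have "H j powr p \<le> norm (h x) powr p"
              using A_bounds(1)[OF True] p_gt by (intro powr_mono2) (auto simp: H_def n_def)
            then show ?thesis using True
              by (simp add: ennreal_mult[symmetric] ennreal_leI mult_right_mono)
          qed simp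
        qed
        finally show ?thesis by (simp add: n_def)
      qed
      have "ennreal (c * (\<Sum>j\<in>J. ?B j)) = (\<Sum>j\<in>J. ennreal (c * ?B j))"
        using c by (simp add: sum_ennreal sum_distrib_left)
      also have "\<dots> \<le> (\<Sum>j\<in>J. \<integral>\<^sup>+x. ennreal (?w x) * indicator (A (Max (G j))) x \<partial>M)"
        by (intro sum_mono term_le)
      also have "\<dots> = (\<integral>\<^sup>+x. (\<Sum>j\<in>J. ennreal (?w x) * indicator (A (Max (G j))) x) \<partial>M)"
        by (subst nn_integral_sum) auto
      \<comment> \<open>The selected levels are disjoint for different j, because
        \<open>\<iota>\<close> of the level recovers j.\<close>
      also have "\<dots> \<le> (\<integral>\<^sup>+x. ennreal (?w x) \<partial>M)"
      proof (rule nn_integral_mono)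
        fix x
        have "(\<Sum>j\<in>J. ennreal (?w x) * indicator (A (Max (G j))) x)
            \<le> (\<Sum>j\<in>J. if j = \<iota> (\<nu> x) then ennreal (?w x) else 0)"
        proof (rule sum_mono)
          fix j assume j: "j \<in> J"
          have "Max (G j) \<in> G j" using G G_ne[OF j] by (rule Max_in)
          then have "\<iota> (Max (G j)) = j" by (simp add: G_def)
          then show "ennreal (?w x) * indicator (A (Max (G j))) x \<le> (if j = \<iota> (\<nu> x) then ennreal (?w x) else 0)"
            by (auto simp: indicator_def A_def)
        qed
        also have "\<dots> \<le> ennreal (?w x)" using J by simp
        finally show "(\<Sum>j\<in>J. ennreal (?w x) * indicator (A (Max (G j))) x) \<le> ennreal (?w x)" .
      qed
      also note hS
      finally have "c * (\<Sum>j\<in>J. ?B j) \<le> S" using S by (simp add: ennreal_le_iff)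
      then have T: "(\<Sum>j\<in>J. ?B j) \<le> 1 / c * S" using c by (simp add: field_simps)
      have "(\<Sum>j\<in>J. (V j powr \<sigma> * H j) powr q) = (\<Sum>j\<in>J. ?B j powr (q / p))"
        using p_gt by (simp add: powr_powr)
      \<comment> \<open>Here p \<le> q enters: the pieces add up in l^p on the source side and in
        l^q on the target side.\<close>
      also have "\<dots> \<le> (\<Sum>j\<in>J. ?B j) powr (q / p)"
        using J p_gt p_le_q by (intro sum_powr_le_powr_sum) auto
      also have "\<dots> \<le> (1 / c * S) powr (q / p)"
        using T p_gt q_gt by (intro powr_mono2 sum_nonneg) auto
      also have "\<dots> = (1 / c) powr (q / p) * S powr (q / p)"
        using c S by (intro powr_mult)
      finally show "(\<Sum>j\<in>J. (V j powr \<sigma> * H j) powr q) \<le> (1 / c) powr (q / p) * S powr (q / p)" .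
    qed (use Cp in simp)
    finally show "(\<integral>\<^sup>+x. ennreal (norm (F h x) powr q * \<rho> x powr (\<alpha> * q)) \<partial>M)
        \<le> ennreal (CJ powr (q - 1) * Cp * (1 / c) powr (q / p) * S powr (q / p))"
      by (simp add: mult.assoc)
  qed
qed

text \<open>The truncations are dominated by |f| and their bound is uniform, so Fatou's lemma
  reaches the limit. Membership of the transform belongs to the claim because the Bochner integral
  of a nonintegrable function is 0, which would make the inequality empty.\<close>

theorem pitt_inequality:
  obtains C where
    "\<And>f. f \<in> weighted_Lp M (\<lambda>x. \<rho> x powr (l * p)) p \<Longrightarrow>
       L1_L2_extension M F f \<in> weighted_Lp M (\<lambda>x. \<rho> x powr (\<alpha> * q)) q \<and>
       (\<integral>x. norm (L1_L2_extension M F f x) powr q * \<rho> x powr (\<alpha> * q) \<partial>M) powr (1 / q)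
         \<le> C * (\<integral>x. norm (f x) powr p * \<rho> x powr (l * p) \<partial>M) powr (1 / p)"
proof -
  obtain C where C: "C \<ge> 0" and bd: "\<And>h B S. h \<in> Lp_space M 2 \<Longrightarrow> B > 0 \<Longrightarrow>
       (\<And>x. x \<in> space M \<Longrightarrow> h x = 0 \<or> 1 / B \<le> norm (h x) \<and> norm (h x) \<le> B) \<Longrightarrow> S \<ge> 0 \<Longrightarrow>
       (\<integral>\<^sup>+x. ennreal (norm (h x) powr p * \<rho> x powr (l * p)) \<partial>M) \<le> ennreal S \<Longrightarrow>
       (\<integral>\<^sup>+x. ennreal (norm (F h x) powr q * \<rho> x powr (\<alpha> * q)) \<partial>M) \<le> ennreal (C * S powr (q / p))"
    using bounded_below_case by blast
  show ?thesis
  proof (rule that[of "C powr (1 / q)"])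
    fix f assume f: "f \<in> weighted_Lp M (\<lambda>x. \<rho> x powr (l * p)) p"
    let ?w = "\<lambda>x. norm (f x) powr p * \<rho> x powr (l * p)"
    define S where "S = (\<integral>x. ?w x \<partial>M)"
    have S: "S \<ge> 0" by (simp add: S_def)
    have f_meas [measurable]: "f \<in> borel_measurable M" and fi: "integrable M ?w"
      using f by (auto simp: weighted_Lp_def)
    define g where "g = L1_L2_extension M F f"
    have ext: "extends_to f g"
    proof -
      obtain f1 f2 where "f1 \<in> Lp_space M 1" "f2 \<in> Lp_space M 2" "\<And>x. x \<in> space M \<Longrightarrow> f x = f1 x + f2 x"
        using in_L1_plus_L2[OF f_meas fi] by blast
      then have "\<exists>g. extends_to f g" by (intro extension_exists) auto
      moreover have "g = (SOME g. extends_to f g)"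
        by (simp add: g_def L1_L2_extension_def extends_to_def)
      ultimately show ?thesis by (metis someI_ex)
    qed
    then have g_meas [measurable]: "g \<in> borel_measurable M" by (simp add: extends_to_def)
    obtain h where h2: "\<And>n::nat. h n \<in> Lp_space M 2"
      and hB: "\<And>n. \<exists>B>0. \<forall>x\<in>space M. h n x = 0 \<or> (h n x = f x \<and> 1 / B \<le> norm (f x) \<and> norm (f x) \<le> B)"
      and lim: "AE x in M. (\<lambda>n. F (h n) x) \<longlonglongrightarrow> g x"
      using extension_approximation[OF ext f_meas] by blast
    have [measurable]: "F (h n) \<in> borel_measurable M" for n using F_measurable[OF h2] .
    let ?u = "\<lambda>n x. ennreal (norm (F (h n) x) powr q * \<rho> x powr (\<alpha> * q))"
    have bn: "(\<integral>\<^sup>+x. ?u n x \<partial>M) \<le> ennreal (C * S powr (q / p))" for n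
    proof -
      obtain B where B: "B > 0"
        "\<And>x. x \<in> space M \<Longrightarrow> h n x = 0 \<or> (h n x = f x \<and> 1 / B \<le> norm (f x) \<and> norm (f x) \<le> B)"
        using hB by blast
      have "(\<integral>\<^sup>+x. ennreal (norm (h n x) powr p * \<rho> x powr (l * p)) \<partial>M) \<le> (\<integral>\<^sup>+x. ennreal (?w x) \<partial>M)"
      proof (rule nn_integral_mono)
        fix x assume "x \<in> space M"
        then show "ennreal (norm (h n x) powr p * \<rho> x powr (l * p)) \<le> ennreal (?w x)"
          using B(2)[of x] by (auto intro!: ennreal_leI)
      qed
      also have "\<dots> = ennreal S" unfolding S_def using fi by (intro nn_integral_eq_integral) auto
      finally show ?thesis using B by (intro bd[OF h2 B(1)] S) metis+
    qed
    have "(\<integral>\<^sup>+x. ennreal (norm (g x) powr q * \<rho> x powr (\<alpha> * q)) \<partial>M) = (\<integral>\<^sup>+x. liminf (\<lambda>n. ?u n x) \<partial>M)"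
    proof (rule nn_integral_cong_AE, use lim in eventually_elim)
      case (elim x)
      have "(\<lambda>n. ?u n x) \<longlonglongrightarrow> ennreal (norm (g x) powr q * \<rho> x powr (\<alpha> * q))"
        using elim q_gt by (intro tendsto_ennrealI tendsto_intros tendsto_powr') auto
      then show ?case by (rule lim_imp_Liminf[OF trivial_limit_sequentially, symmetric])
    qed
    also have "\<dots> \<le> liminf (\<lambda>n. \<integral>\<^sup>+x. ?u n x \<partial>M)" by (rule nn_integral_liminf) simp
    also have "\<dots> \<le> liminf (\<lambda>n. ennreal (C * S powr (q / p)))"
      by (intro Liminf_mono always_eventually allI bn)
    also have "\<dots> = ennreal (C * S powr (q / p))" by (simp add: Liminf_const)
    finally have le: "(\<integral>\<^sup>+x. ennreal (norm (g x) powr q * \<rho> x powr (\<alpha> * q)) \<partial>M) \<le> ennreal (C * S powr (q / p))" .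
    have gi: "integrable M (\<lambda>x. norm (g x) powr q * \<rho> x powr (\<alpha> * q))"
    proof (rule integrableI_bounded)
      show "(\<integral>\<^sup>+x. ennreal (norm (norm (g x) powr q * \<rho> x powr (\<alpha> * q))) \<partial>M) < \<infinity>"
        using le_less_trans[OF le ennreal_less_top] by simp
    qed simp
    have "ennreal (\<integral>x. norm (g x) powr q * \<rho> x powr (\<alpha> * q) \<partial>M) \<le> ennreal (C * S powr (q / p))"
      using le nn_integral_eq_integral[OF gi] by simp
    then have "(\<integral>x. norm (g x) powr q * \<rho> x powr (\<alpha> * q) \<partial>M) \<le> C * S powr (q / p)"
      using C by (simp add: ennreal_le_iff)
    then have "(\<integral>x. norm (g x) powr q * \<rho> x powr (\<alpha> * q) \<partial>M) powr (1 / q) \<le> (C * S powr (q / p)) powr (1 / q)"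
      using q_gt by (intro powr_mono2) auto
    also have "\<dots> = C powr (1 / q) * S powr (1 / p)"
      using C q_gt by (simp add: powr_mult powr_powr)
    finally show "L1_L2_extension M F f \<in> weighted_Lp M (\<lambda>x. \<rho> x powr (\<alpha> * q)) q \<and>
       (\<integral>x. norm (L1_L2_extension M F f x) powr q * \<rho> x powr (\<alpha> * q) \<partial>M) powr (1 / q)
         \<le> C powr (1 / q) * (\<integral>x. norm (f x) powr p * \<rho> x powr (l * p) \<partial>M) powr (1 / p)"
      using gi g_meas by (simp add: weighted_Lp_def g_def[symmetric] S_def)
  qed
qed

end

section \<open>The Dunkl setting\<close>

lemma dunkl_weight_measurable [measurable]: "dunkl_weight P k a \<in> borel_measurable lebesgue"
proof -
  have "dunkl_weight P k a \<in> borel_measurable borel" unfolding dunkl_weight_def by measurable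
  then show ?thesis by (intro measurable_completion) simp
qed

text \<open>Since \<open>0 powr y = 0\<close> for every y, the density vanishes at the origin even
  if a < 2, so the density itself excludes that point.\<close>

lemma AE_dunkl_measure_norm_pos: "AE x in dunkl_measure P k a. norm x > 0"
proof -
  have "(\<lambda>x. ennreal (dunkl_weight P k a x)) \<in> borel_measurable lebesgue" by measurable
  then show ?thesis unfolding dunkl_measure_def 
    by (simp add: AE_density) (auto simp: dunkl_weight_def intro!: AE_I2)
qed

text \<open>The weight is homogeneous of degree a - 2 plus twice the sum of k, and volume adds the
  dimension. As only an upper bound is wanted, Cauchy-Schwarz together with k \<ge> 0 bounds the
  product over the roots, and the shell is enlarged to a ball.\<close>

lemma dunkl_measure_shell:
  fixes P :: "(real ^ 'n) set"
  assumes P: "finite P" and k: "\<And>\<beta>. \<beta> \<in> P \<Longrightarrow> k \<beta> \<ge> 0"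
  obtains K where "K \<ge> 0"
    "\<And>r. r > 0 \<Longrightarrow> emeasure (dunkl_measure P k a)
        {x \<in> space (dunkl_measure P k a). r \<le> norm x \<and> norm x < 2 * r} \<le> ennreal (K * r powr hom_dim P k a)"
proof -
  define c where "c = 2 powr \<bar>a - 2\<bar> * (\<Prod>\<beta>\<in>P. (2 * norm \<beta>) powr (2 * k \<beta>))"
  let ?N = "DIM(real ^ 'n)"
  define K where "K = c * (unit_ball_vol ?N * 2 ^ ?N)"
  have c: "c \<ge> 0" unfolding c_def by (intro mult_nonneg_nonneg prod_nonneg) auto
  show ?thesis
  proof (rule that[of K])
    show "K \<ge> 0" using c by (simp add: K_def)
    fix r :: real assume r: "r > 0"
    let ?e = "a - 2 + 2 * (\<Sum>\<beta>\<in>P. k \<beta>)"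
    let ?S = "{x :: real ^ 'n. r \<le> norm x \<and> norm x < 2 * r}"
    have "?S \<in> sets borel" by measurable
    then have S: "?S \<in> sets lebesgue" by simp
    have w: "dunkl_weight P k a x \<le> c * r powr ?e" if x: "x \<in> ?S" for x
    proof -
      have "(\<Prod>\<beta>\<in>P. \<bar>\<beta> \<bullet> x\<bar> powr (2 * k \<beta>)) \<le> (\<Prod>\<beta>\<in>P. (2 * norm \<beta>) powr (2 * k \<beta>) * r powr (2 * k \<beta>))"
      proof (intro prod_mono conjI)
        fix \<beta> assume \<beta>: "\<beta> \<in> P"
        have "\<bar>\<beta> \<bullet> x\<bar> \<le> norm \<beta> * norm x" by (rule Cauchy_Schwarz_ineq2)
        also have "\<dots> \<le> norm \<beta> * (2 * r)" using x by (intro mult_left_mono) auto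
        finally have "\<bar>\<beta> \<bullet> x\<bar> powr (2 * k \<beta>) \<le> (2 * norm \<beta> * r) powr (2 * k \<beta>)"
          using k[OF \<beta>] by (intro powr_mono2) (auto simp: mult_ac)
        then show "\<bar>\<beta> \<bullet> x\<bar> powr (2 * k \<beta>) \<le> (2 * norm \<beta>) powr (2 * k \<beta>) * r powr (2 * k \<beta>)"
          using r by (subst powr_mult[symmetric]) auto
      qed auto
      also have "\<dots> = (\<Prod>\<beta>\<in>P. (2 * norm \<beta>) powr (2 * k \<beta>)) * r powr (2 * (\<Sum>\<beta>\<in>P. k \<beta>))"
        using r P by (simp add: prod.distrib powr_sum sum_distrib_left)
      finally have "dunkl_weight P k a x \<le> (2 powr \<bar>a - 2\<bar> * r powr (a - 2)) *
          ((\<Prod>\<beta>\<in>P. (2 * norm \<beta>) powr (2 * k \<beta>)) * r powr (2 * (\<Sum>\<beta>\<in>P. k \<beta>)))"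
        unfolding dunkl_weight_def using x r
        by (intro mult_mono powr_dyadic_le prod_nonneg mult_nonneg_nonneg) auto
      then show ?thesis by (simp add: c_def powr_add mult_ac)
    qed
    have "emeasure (dunkl_measure P k a) {x \<in> space (dunkl_measure P k a). r \<le> norm x \<and> norm x < 2 * r}
        = (\<integral>\<^sup>+x. ennreal (dunkl_weight P k a x) * indicator ?S x \<partial>lebesgue)"
      unfolding dunkl_measure_def using S by (subst emeasure_density) auto
    also have "\<dots> \<le> (\<integral>\<^sup>+x. ennreal (c * r powr ?e) * indicator ?S x \<partial>lebesgue)"
      using w by (intro nn_integral_mono) (auto simp: indicator_def intro!: ennreal_leI)
    also have "\<dots> = ennreal (c * r powr ?e) * emeasure lebesgue ?S"
      using S by (simp add: nn_integral_cmult_indicator)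
    also have "\<dots> \<le> ennreal (c * r powr ?e) * emeasure lebesgue (cball (0 :: real ^ 'n) (2 * r))"
      by (intro mult_left_mono emeasure_mono) auto
    also have "emeasure lebesgue (cball (0 :: real ^ 'n) (2 * r)) = ennreal (unit_ball_vol ?N * (2 * r) ^ ?N)"
      using r by (simp add: emeasure_cball)
    also have "ennreal (c * r powr ?e) * ennreal (unit_ball_vol ?N * (2 * r) ^ ?N)
        = ennreal (K * r powr hom_dim P k a)"
    proof -
      have "r powr hom_dim P k a = r powr ?e * r ^ ?N"
        using r by (simp add: hom_dim_def powr_realpow[symmetric] powr_add[symmetric] algebra_simps)
      then show ?thesis
        using c r by (subst ennreal_mult[symmetric]) (auto simp: K_def power_mult_distrib mult_ac)
    qed
    finally show "emeasure (dunkl_measure P k a)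
        {x \<in> space (dunkl_measure P k a). r \<le> norm x \<and> norm x < 2 * r} \<le> ennreal (K * r powr hom_dim P k a)" .
  qed
qed

theorem corollary8p5:
  fixes R P :: "(real ^ 'n) set" and k :: "real ^ 'n \<Rightarrow> real"
    and a p q \<alpha> l :: real
    and F :: "(real ^ 'n \<Rightarrow> complex) \<Rightarrow> (real ^ 'n \<Rightarrow> complex)"
  assumes "reduced_root_system R" and "positive_subsystem R P" and "multiplicity_function R k"
    and "a > 0" and "a + 2 * (\<Sum>\<beta>\<in>P. k \<beta>) + real CARD('n) > 2"
    and "CARD('n) = 1
       \<or> CARD('n) \<ge> 2 \<and> a \<in> {1, 2}
       \<or> CARD('n) = 2 \<and> (\<exists>n::nat. n \<ge> 1 \<and> a = 2 / real n)"
    and "ka_fourier_transform P k a F"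
    and "L1_Linf_bounded (dunkl_measure P k a) F"
    and "1 < p" and "p \<le> q" and "\<alpha> < 0" and "l > 0"
    and "\<alpha> > - hom_dim P k a / q" and "l < hom_dim P k a / p"
    and "1 / hom_dim P k a * (\<alpha> + l) = 1 / (p / (p - 1)) - 1 / q"
  shows "\<exists>C::real. \<forall>f \<in> weighted_Lp (dunkl_measure P k a) (\<lambda>x. norm x powr (l * p)) p.
     (let M = dunkl_measure P k a; Ff = L1_L2_extension M F f in
       Ff \<in> weighted_Lp M (\<lambda>\<xi>. norm \<xi> powr (\<alpha> * q)) q \<and>
       (\<integral>\<xi>. norm (Ff \<xi>) powr q * norm \<xi> powr (\<alpha> * q) \<partial>M) powr (1 / q)
         \<le> C * (\<integral>x. norm (f x) powr p * norm x powr (l * p) \<partial>M) powr (1 / p))"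
proof -
  let ?M = "dunkl_measure P k a" and ?D = "hom_dim P k a"
  have P: "P \<subseteq> R" using assms(2) by (auto simp: positive_subsystem_def)
  then have fin: "finite P" using assms(1) by (auto simp: reduced_root_system_def intro: finite_subset)
  have k: "k \<beta> \<ge> 0" if "\<beta> \<in> P" for \<beta> using that P assms(3) by (auto simp: multiplicity_function_def)
  obtain K where K: "K \<ge> 0" "\<And>r. r > 0 \<Longrightarrow>
      emeasure ?M {x \<in> space ?M. r \<le> norm x \<and> norm x < 2 * r} \<le> ennreal (K * r powr ?D)"
    by (rule dunkl_measure_shell[where k = k and a = a, OF fin]) (erule k, rule that, assumption+)
  obtain C0 where C0: "C0 \<ge> 0" "\<And>f. f \<in> Lp_space ?M 1 \<Longrightarrow> f \<in> Lp_space ?M 2 \<Longrightarrow>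
      Linf_norm ?M (F f) \<le> ennreal (C0 * (\<integral>x. norm (f x) \<partial>?M))"
    using assms(8) unfolding L1_Linf_bounded_def by blast
  \<comment> \<open>The assumption on a, k and the dimension says exactly that the homogeneous
    dimension is positive.\<close>
  have D: "?D > 0" using assms(5) by (simp add: hom_dim_def)
  have norm_meas: "(norm :: real ^ 'n \<Rightarrow> real) \<in> borel_measurable ?M"
    unfolding dunkl_measure_def by (simp add: measurable_completion)
  have "1 / (p / (p - 1)) = 1 - 1 / p" using assms(9) by (simp add: diff_divide_distrib)
  then have e: "(\<alpha> + l) / ?D = 1 - 1 / p - 1 / q" using assms(15) by simp
  have unitary: "unitary_on_L2 ?M F" using assms(7) by (simp add: ka_fourier_transform_def)
  interpret pitt_setting ?M "norm :: real ^ 'n \<Rightarrow> real" ?D K F C0 p q \<alpha> l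
    by (intro pitt_setting.intro gauge_space.intro L1_L2_operator.intro pitt_setting_axioms.intro)
      (rule norm_meas AE_dunkl_measure_norm_pos D K unitary C0 e assms(9-13) | assumption)+
  obtain C where "\<And>f. f \<in> weighted_Lp ?M (\<lambda>x. norm x powr (l * p)) p \<Longrightarrow>
       L1_L2_extension ?M F f \<in> weighted_Lp ?M (\<lambda>x. norm x powr (\<alpha> * q)) q \<and>
       (\<integral>x. norm (L1_L2_extension ?M F f x) powr q * norm x powr (\<alpha> * q) \<partial>?M) powr (1 / q)
         \<le> C * (\<integral>x. norm (f x) powr p * norm x powr (l * p) \<partial>?M) powr (1 / p)"
    by (rule pitt_inequality) (rule that, assumption)
  then show ?thesis unfolding Let_def by blast
qed

end
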